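(* Let $B\in\mathbb{R}^{m\times m}$ be symmetric positive definite and let $X\in\mathbb{R}^{m\times n}$ with $m\ge n$ satisfy $$\mathbf{u}^{-1/2}<\frac{\|X\|_2\sqrt{\|B\|_2}}{\sqrt{\sigma_n(X^{\top}BX)}}\le\frac{\mathbf{u}^{-1}}{96\{2m\sqrt{mn}+n(n+1)\}\sqrt{\kappa_2(B)}},$$ and suppose $80\,\kappa_2(B)\,(m\sqrt{mn}\,\mathbf{u}+n(n+1)\mathbf{u})\le1$. Then shiftedCholeskyQR followed by CholeskyQR2 (the algorithm shiftedCholeskyQR3 in the $B$-inner product), run in floating-point arithmetic, computes a QR factorization $X\approx\hat Q\hat R$ satisfying the $B$-orthogonality measure $$\|\hat Q^{\top}B\hat Q-I\|_F\le 8\,[m\sqrt{mn}\,\mathbf{u}+n(n+1)\mathbf{u}]\,\kappa_2(B)$$ and the backward error bound $$\frac{\|\hat Q\hat R-X\|_F}{\|X\|_2}\le 16n^2\mathbf{u}\,(\kappa_2(B))^{3/2}.$$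
   Context: $\mathbf{u}$ is the unit roundoff, and $\gamma_k:=\frac{k\mathbf{u}}{1-k\mathbf{u}}$. $|M|$ is the matrix of absolute values of the entries of $M$, and inequalities between matrices are entrywise. $\|\cdot\|_2$, $\|\cdot\|_F$ are the spectral and Frobenius norms; $\kappa_2(B)=\|B\|_2\|B^{-1}\|_2$; for an $n\times n$ matrix $M$, $\sigma_n(M)$ is its smallest singular value. $\mathrm{chol}(H)$ denotes the upper triangular Cholesky factor $R$ with $R^{\top}R=H$. Algorithm shiftedCholeskyQR3 in the inner product $(x,y)_B=x^{\top}By$ (one shifted Cholesky QR step followed by CholeskyQR2, i.e. two unshifted Cholesky QR steps): 1. $Q:=X$; $A:=Q^{\top}BQ$; $s:=11\{2m\sqrt{mn}+n(n+1)\}\mathbf{u}\|X\|_2^2\|B\|_2$; $R:=\mathrm{chol}(A+sI)$; $Q:=QR^{-1}$. 2. $\tilde R:=\mathrm{chol}(Q^{\top}BQ)$, $Q:=Q\tilde R^{-1}$, $R:=\tilde RR$. 3. $\tilde R:=\mathrm{chol}(Q^{\top}BQ)$, $Q:=Q\tilde R^{-1}$, $R:=\tilde RR$. The output is the final $Q,R$; the matrices $\hat Q,\hat R$ in the claim are the final computed ones, and $\hat Q\hat R$ is their exact product. Floating-point model: - A Gram matrix $Y^{\top}BY$ of an $m\times n$ matrix $Y$ is computed as a symmetric matrix $Y^{\top}BY+E_1$; the standard rounding error bounds for the two matrix products give $\|E_1\|_2\le2.2\,m\sqrt{mn}\,\mathbf{u}\|Y\|_2^2\|B\|_2$. - The computed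 Cholesky factor $\hat T$ of a symmetric $n\times n$ matrix $H$ (where $H$ is the computed Gram matrix, plus $sI$ in the shifted step) is upper triangular and nonsingular and satisfies $\hat T^{\top}\hat T=H+E_2$ with $|E_2|\le\gamma_{n+1}|\hat T|^{\top}|\hat T|$; the floating-point factorization runs to completion whenever $H$ is positive definite with $\lambda_{\min}(H)\ge\sum_{i=1}^n\frac{\gamma_{i+1}}{1-\gamma_{i+1}}\|H\|_2$. - $Y\hat T^{-1}$ is computed row by row by triangular solves: the $i$th computed row $\hat z_i^{\top}$ satisfies $\hat z_i^{\top}(\hat T+\Delta\hat T_i)=y_i^{\top}$ with $|\Delta\hat T_i|\le\gamma_n|\hat T|$, where $y_i^{\top}$ is the $i$th row of $Y$. - A product $ST$ of $n\times n$ matrices is computed with error bounded entrywise by $\gamma_n|S||T|$. *)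

theory Defs
  imports "HOL-Analysis.Analysis"
begin

text \<open>
  Matrices are of type \<^typ>\<open>real^'n^'m\<close> (\<open>m\<close> rows, \<open>n\<close> columns). The library's \<^const>\<open>norm\<close> on
  this type is the Frobenius norm, \<open>\<bar>M\<bar>\<close> is the matrix of absolute values and \<open>\<le>\<close> is the entrywise
  order. The column index type is linearly ordered so that triangularity makes sense.
\<close>

definition spectral_norm :: "real^'n^'m \<Rightarrow> real" where
  "spectral_norm M = onorm (\<lambda>x. M *v x)"

definition cond2 :: "real^'n^'n \<Rightarrow> real" where
  "cond2 M = spectral_norm M * spectral_norm (matrix_inv M)"

definition pos_def :: "real^'n^'n \<Rightarrow> bool" where
  "pos_def M \<longleftrightarrow> transpose M = M \<and> (\<forall>x. x \<noteq> 0 \<longrightarrow> 0 < x \<bullet> (M *v x))"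

definition eigenvalue :: "real^'n^'n \<Rightarrow> real \<Rightarrow> bool" where
  "eigenvalue M l \<longleftrightarrow> (\<exists>v. v \<noteq> 0 \<and> M *v v = l *\<^sub>R v)"

text \<open>Only used for symmetric \<open>M\<close>, whose real spectrum is finite and nonempty.\<close>

definition lambda_min :: "real^'n^'n \<Rightarrow> real" where
  "lambda_min M = (LEAST l. eigenvalue M l)"

definition singular_value :: "real^'n^'n \<Rightarrow> real \<Rightarrow> bool" where
  "singular_value M s \<longleftrightarrow> 0 \<le> s \<and> eigenvalue (transpose M ** M) (s\<^sup>2)"

definition sigma_min :: "real^'n^'n \<Rightarrow> real" where
  "sigma_min M = (LEAST s. singular_value M s)"

definition upper_triangular :: "real^('n::{finite,linorder})^('n::{finite,linorder}) \<Rightarrow> bool" where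
  "upper_triangular T \<longleftrightarrow> (\<forall>i j. j < i \<longrightarrow> T $ i $ j = 0)"

definition gamma_fl :: "real \<Rightarrow> nat \<Rightarrow> real" where
  "gamma_fl u k = real k * u / (1 - real k * u)"

text \<open>
  The floating-point operations are relations between exact inputs and admissible computed results;
  \<open>u\<close> is the unit roundoff.

  Gram matrix: \<open>C\<close> and \<open>P\<close> are the computed products \<open>B Y\<close> and \<open>Y\<^sup>T C\<close>, subject to the standard
  rounding error bounds, and \<open>G\<close> is the computed symmetric matrix. Each entry of \<open>G\<close> lies between the
  two entries of \<open>P\<close> that should be equal, which covers computing one triangle and mirroring it as
  well as averaging (and, by transposition, multiplying in the order \<open>(Y\<^sup>T B) Y\<close>). The last conjunct
  is the resulting spectral norm bound. It does not make the entrywise bounds redundant: a bound on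
  the spectral norm alone controls the Frobenius norm of the error only up to a factor \<open>sqrt n\<close>.
\<close>

definition fl_gram :: "real \<Rightarrow> real^'m^'m \<Rightarrow> real^'n^'m \<Rightarrow> real^'n^'n \<Rightarrow> bool" where
  "fl_gram u B Y G \<longleftrightarrow>
     transpose G = G \<and>
     (\<exists>C P. \<bar>C - B ** Y\<bar> \<le> gamma_fl u CARD('m) *\<^sub>R (\<bar>B\<bar> ** \<bar>Y\<bar>) \<and>
            \<bar>P - transpose Y ** C\<bar> \<le> gamma_fl u CARD('m) *\<^sub>R (transpose \<bar>Y\<bar> ** \<bar>C\<bar>) \<and>
            (\<forall>i j. G $ i $ j \<in> closed_segment (P $ i $ j) (P $ j $ i))) \<and>
     spectral_norm (G - transpose Y ** B ** Y)
       \<le> 2.2 * real CARD('m) * sqrt (real CARD('m) * real CARD('n)) * u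
           * (spectral_norm Y)\<^sup>2 * spectral_norm B"

text \<open>\<^const>\<open>None\<close> is a breakdown of the factorization.\<close>

inductive fl_chol ::
    "real \<Rightarrow> real^('n::{finite,linorder})^('n::{finite,linorder})
      \<Rightarrow> (real^('n::{finite,linorder})^('n::{finite,linorder})) option \<Rightarrow> bool"
  for u :: real and H :: "real^('n::{finite,linorder})^('n::{finite,linorder})" where
  success: "fl_chol u H (Some T)"
    if "upper_triangular T" "invertible T"
       "\<bar>transpose T ** T - H\<bar> \<le> gamma_fl u (CARD('n) + 1) *\<^sub>R (transpose \<bar>T\<bar> ** \<bar>T\<bar>)"
| breakdown: "fl_chol u H None"
    if "\<not> (pos_def H \<and>
            (\<Sum>i = 1..CARD('n). gamma_fl u (i + 1) / (1 - gamma_fl u (i + 1))) * spectral_norm H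
              \<le> lambda_min H)"

text \<open>Row-wise triangular solves: the perturbation of \<open>T\<close> may differ from row to row.\<close>

definition fl_solve :: "real \<Rightarrow> real^'n^'m \<Rightarrow> real^'n^'n \<Rightarrow> real^'n^'m \<Rightarrow> bool" where
  "fl_solve u Y T Z \<longleftrightarrow>
     (\<forall>i. \<exists>D. \<bar>D\<bar> \<le> gamma_fl u CARD('n) *\<^sub>R \<bar>T\<bar> \<and> row i Z v* (T + D) = row i Y)"

definition fl_mult :: "real \<Rightarrow> real^'n^'n \<Rightarrow> real^'n^'n \<Rightarrow> real^'n^'n \<Rightarrow> bool" where
  "fl_mult u S T P \<longleftrightarrow> \<bar>P - S ** T\<bar> \<le> gamma_fl u CARD('n) *\<^sub>R (\<bar>S\<bar> ** \<bar>T\<bar>)"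

text \<open>Pairs \<open>(Q, R)\<close> of types \<open>real^'n^'m\<close> and \<open>real^'n^'n\<close>.\<close>

type_synonym ('m, 'n) factors = "((real, 'n) vec, 'm) vec \<times> ((real, 'n) vec, 'n) vec"

text \<open>
  One Cholesky QR step with shift \<open>s\<close> applied to \<open>Y\<close>, returning the new \<open>Q\<close> and the Cholesky factor.
  Note that \<^term>\<open>mat s\<close> is \<open>s I\<close>.
\<close>

inductive cholesky_qr_run ::
    "real \<Rightarrow> real^'m^'m \<Rightarrow> real \<Rightarrow> real^('n::{finite,linorder})^'m
      \<Rightarrow> ('m, 'n::{finite,linorder}) factors option \<Rightarrow> bool"
  for u :: real and B :: "real^'m^'m" and s :: real and Y :: "real^('n::{finite,linorder})^'m" where
  success: "cholesky_qr_run u B s Y (Some (Z, T))"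
    if "fl_gram u B Y G" "fl_chol u (G + mat s) (Some T)" "fl_solve u Y T Z"
| breakdown: "cholesky_qr_run u B s Y None"
    if "fl_gram u B Y G" "fl_chol u (G + mat s) None"

text \<open>An unshifted Cholesky QR step updating the current factors \<open>Q\<close>, \<open>R\<close>.\<close>

inductive reorthogonalize_run ::
    "real \<Rightarrow> real^'m^'m \<Rightarrow> ('m, 'n) factors \<Rightarrow> ('m, 'n::{finite,linorder}) factors option \<Rightarrow> bool"
  for u :: real and B :: "real^'m^'m" where
  success: "reorthogonalize_run u B (Q, R) (Some (Q', R'))"
    if "cholesky_qr_run u B 0 Q (Some (Q', T))" "fl_mult u T R R'"
| breakdown: "reorthogonalize_run u B (Q, R) None"
    if "cholesky_qr_run u B 0 Q None"

definition cholesky_shift :: "real \<Rightarrow> real^'m^'m \<Rightarrow> real^'n^'m \<Rightarrow> real" where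
  "cholesky_shift u B X =
     11 * (2 * real CARD('m) * sqrt (real CARD('m) * real CARD('n))
           + real CARD('n) * (real CARD('n) + 1)) * u
        * (spectral_norm X)\<^sup>2 * spectral_norm B"

inductive shifted_cholesky_qr3_run ::
    "real \<Rightarrow> real^'m^'m \<Rightarrow> real^('n::{finite,linorder})^'m
      \<Rightarrow> ('m, 'n::{finite,linorder}) factors option \<Rightarrow> bool"
  for u :: real and B :: "real^'m^'m" and X :: "real^('n::{finite,linorder})^'m" where
  success: "shifted_cholesky_qr3_run u B X (Some QR3)"
    if "cholesky_qr_run u B (cholesky_shift u B X) X (Some QR1)"
       "reorthogonalize_run u B QR1 (Some QR2)"
       "reorthogonalize_run u B QR2 (Some QR3)"
| breakdown1: "shifted_cholesky_qr3_run u B X None"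
    if "cholesky_qr_run u B (cholesky_shift u B X) X None"
| breakdown2: "shifted_cholesky_qr3_run u B X None"
    if "cholesky_qr_run u B (cholesky_shift u B X) X (Some QR1)"
       "reorthogonalize_run u B QR1 None"
| breakdown3: "shifted_cholesky_qr3_run u B X None"
    if "cholesky_qr_run u B (cholesky_shift u B X) X (Some QR1)"
       "reorthogonalize_run u B QR1 (Some QR2)"
       "reorthogonalize_run u B QR2 None"

end

theory Submission
  imports Defs
begin

text \<open>
  Norms \<open>\<parallel>v\<parallel>\<close> and \<open>\<parallel>M\<parallel>\<close> in these comments are Euclidean and spectral norms. Factor \<open>B = L\<^sup>T L\<close>. Then \<open>Y\<^sup>T B Y = (L Y)\<^sup>T (L Y)\<close> for every \<open>Y\<close>, so the run of the algorithm on \<open>X\<close> is a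
  run of ordinary Cholesky QR on \<open>L X\<close>, except that rounding errors are committed on \<open>Y\<close> instead of
  \<open>L Y\<close>. Moving an error from one side to the other costs the norm of \<open>L\<close> or of its inverse, together a
  factor \<open>sqrt (cond2 B)\<close>; this is where every power of the condition number comes from.

  A single step with shift \<open>s\<close> computes a triangular \<open>T\<close> with \<open>T\<^sup>T T = (L Y)\<^sup>T (L Y) + s I + E\<close>, where \<open>E\<close>
  collects the errors of the Gram matrix and of the factorization (\<open>gram_shift_factor\<close>). Hence
  \<open>\<parallel>T w\<parallel>\<^sup>2\<close> and \<open>\<parallel>L Y w\<parallel>\<^sup>2 + s \<parallel>w\<parallel>\<^sup>2\<close> differ by at most \<open>\<parallel>E\<parallel> \<parallel>w\<parallel>\<^sup>2\<close>, and this comparison of two quadratic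
  forms bounds the singular values of the exact quotient \<open>L Y T\<^sup>-\<^sup>1\<close> from both sides. The triangular solves
  perturb the quotient by a relative amount of order
  \<open>\<eta> = n\<^sup>2 u sqrt (cond2 B) \<parallel>T\<parallel> \<parallel>T\<^sup>-\<^sup>1\<parallel>\<close> (\<open>triangular_solve_perturbation\<close>).

  Let \<open>g = (2 m sqrt (m n) + n (n + 1)) u\<close> and \<open>\<rho>\<^sup>2 = g cond2 B\<close>, which is at most \<open>1 / 40\<close>.
  In the first step the shift is several times larger than \<open>E\<close>, so the factorization cannot break
  down, and \<open>\<parallel>T\<parallel> \<parallel>T\<^sup>-\<^sup>1\<parallel>\<close> is at most of order \<open>g\<close> to the power \<open>-1/2\<close>, which makes \<open>\<eta>\<close> of order \<open>\<rho>\<close>. The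
  hypothesis on \<open>X\<close> says that the smallest eigenvalue of \<open>X\<^sup>T B X\<close> is at least of order \<open>\<rho>\<^sup>2 s\<close>; so the
  shift destroys orthogonality, but the singular values of the first \<open>L Q\<close> stay between \<open>6 \<rho>\<close> and
  \<open>1.022\<close> (\<open>first_step\<close>). Now the Gram matrix has eigenvalues at least \<open>36 \<rho>\<^sup>2\<close>, while \<open>\<parallel>E\<parallel>\<close> is at most
  \<open>1.17 \<rho>\<^sup>2\<close>: the unshifted second step succeeds and brings the singular values to within a few percent
  of \<open>1\<close> (\<open>second_step\<close>). From such a matrix the third step loses only its own rounding errors
  (\<open>third_step\<close>), which gives the orthogonality bound.

  For that bound the error of the Gram matrix is needed in the Frobenius norm without a spurious factor
  \<open>sqrt n\<close>; it is obtained by estimating the two matrix products separately (\<open>fl_gram_norm_error\<close>).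
  The backward error is a telescoping sum of five residuals, each of which is at most a small multiple of
  \<open>n\<^sup>2 u sqrt (cond2 B) \<parallel>X\<parallel>\<close> (\<open>three_step_backward_error\<close>).
\<close>

section \<open>Spectral and Frobenius norms\<close>

lemma norm_matrix_power2: "(norm M)\<^sup>2 = (\<Sum>i\<in>UNIV. (norm (M $ i))\<^sup>2)" for M :: "real^'n^'m"
  by (simp add: power2_norm_eq_inner inner_vec_def)

lemma norm_transpose: "norm (transpose M) = norm M" for M :: "real^'n^'m"
proof -
  have "(norm (transpose M))\<^sup>2 = (norm M)\<^sup>2"
    unfolding power2_norm_eq_inner inner_vec_def transpose_def
    by (simp add: sum.swap[of _ "UNIV :: 'n set"])
  then show ?thesis by simp
qed

text \<open>
  All entrywise rounding error bounds below are converted into Frobenius norms: this norm does not see the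
  absolute values that occur in them, whereas the spectral norm of \<open>\<bar>M\<bar>\<close> may exceed that of \<open>M\<close>.
\<close>

lemma norm_entrywise_mono:
  fixes M P :: "real^'n^'m"
  assumes "\<bar>M\<bar> \<le> P"
  shows "norm M \<le> norm P"
proof -
  have "\<bar>M $ i $ j\<bar> \<le> P $ i $ j" for i j
    using assms unfolding less_eq_vec_def abs_vec_def by simp
  then have "norm (M $ i) \<le> norm (P $ i)" for i
    by (intro norm_le_componentwise_cart) (force intro: order_trans[OF _ abs_ge_self])
  then show ?thesis by (rule norm_le_componentwise_cart)
qed

lemma norm_abs_matrix: "norm \<bar>M\<bar> = norm M" for M :: "real^'n^'m"
  by (simp add: norm_eq_sqrt_inner inner_vec_def abs_vec_def)

lemma norm_matrix_vector_le: "norm (M *v v) \<le> spectral_norm M * norm v" for M :: "real^'n^'m"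
  unfolding spectral_norm_def by (rule onorm) (rule matrix_vector_mul_bounded_linear)

lemma spectral_norm_le:
  fixes M :: "real^'n^'m"
  shows "(\<And>v. norm (M *v v) \<le> c * norm v) \<Longrightarrow> spectral_norm M \<le> c"
  unfolding spectral_norm_def by (rule onorm_le)

lemma spectral_norm_nonneg [simp]: "0 \<le> spectral_norm M" for M :: "real^'n^'m"
  unfolding spectral_norm_def by (rule onorm_pos_le) (rule matrix_vector_mul_bounded_linear)

lemma spectral_norm_add_le: "spectral_norm (M + P) \<le> spectral_norm M + spectral_norm P"
  for M P :: "real^'n^'m"
proof (rule spectral_norm_le)
  fix v
  have "norm ((M + P) *v v) \<le> norm (M *v v) + norm (P *v v)"
    by (simp add: matrix_vector_mult_add_rdistrib norm_triangle_ineq)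
  then show "norm ((M + P) *v v) \<le> (spectral_norm M + spectral_norm P) * norm v"
    using norm_matrix_vector_le[of M v] norm_matrix_vector_le[of P v] by (simp add: distrib_right)
qed

lemma spectral_norm_mult_le: "spectral_norm (M ** P) \<le> spectral_norm M * spectral_norm P"
  for M :: "real^'n^'m" and P :: "real^'k^'n"
proof (rule spectral_norm_le)
  fix v
  have "norm ((M ** P) *v v) \<le> spectral_norm M * norm (P *v v)"
    unfolding matrix_vector_mul_assoc[symmetric] by (rule norm_matrix_vector_le)
  also have "\<dots> \<le> spectral_norm M * (spectral_norm P * norm v)"
    by (intro mult_left_mono norm_matrix_vector_le) simp
  finally show "norm ((M ** P) *v v) \<le> spectral_norm M * spectral_norm P * norm v" by simp
qed

lemma inner_transpose: "v \<bullet> (transpose M *v w) = (M *v v) \<bullet> w" for M :: "real^'n^'m"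
  by (metis dot_lmul_matrix inner_commute transpose_matrix_vector)

lemma inner_gram: "v \<bullet> ((transpose M ** M) *v v) = (norm (M *v v))\<^sup>2" for M :: "real^'n^'m"
  by (simp add: matrix_vector_mul_assoc[symmetric] inner_transpose power2_norm_eq_inner
      del: transpose_matrix_vector)

lemma spectral_norm_transpose_le: "spectral_norm (transpose M) \<le> spectral_norm M"
  for M :: "real^'n^'m"
proof (rule spectral_norm_le)
  fix v
  have "(norm (transpose M *v v))\<^sup>2 = (M *v (transpose M *v v)) \<bullet> v"
    unfolding power2_norm_eq_inner inner_transpose ..
  also have "\<dots> \<le> norm (M *v (transpose M *v v)) * norm v" by (rule norm_cauchy_schwarz)
  also have "\<dots> \<le> spectral_norm M * norm (transpose M *v v) * norm v"
    by (intro mult_right_mono norm_matrix_vector_le) simp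
  finally have "norm (transpose M *v v) * norm (transpose M *v v)
      \<le> (spectral_norm M * norm v) * norm (transpose M *v v)"
    by (simp add: power2_eq_square mult_ac)
  then show "norm (transpose M *v v) \<le> spectral_norm M * norm v"
    by (cases "norm (transpose M *v v) = 0") auto
qed

lemma spectral_norm_transpose [simp]: "spectral_norm (transpose M) = spectral_norm M"
  for M :: "real^'n^'m"
  using spectral_norm_transpose_le[of M] spectral_norm_transpose_le[of "transpose M"] by simp

lemma abs_inner_matrix_le: "\<bar>v \<bullet> (M *v v)\<bar> \<le> spectral_norm M * (norm v)\<^sup>2" for M :: "real^'n^'n"
proof -
  have "\<bar>v \<bullet> (M *v v)\<bar> \<le> norm v * norm (M *v v)" by (rule Cauchy_Schwarz_ineq2)
  also have "\<dots> \<le> norm v * (spectral_norm M * norm v)"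
    by (intro mult_left_mono norm_matrix_vector_le) simp
  finally show ?thesis by (simp add: power2_eq_square mult_ac)
qed

lemma spectral_norm_power2_le_gram: "(spectral_norm M)\<^sup>2 \<le> spectral_norm (transpose M ** M)"
  for M :: "real^'n^'m"
proof -
  have "spectral_norm M \<le> sqrt (spectral_norm (transpose M ** M))"
  proof (rule spectral_norm_le)
    fix v
    have "(norm (M *v v))\<^sup>2 \<le> spectral_norm (transpose M ** M) * (norm v)\<^sup>2"
      using abs_inner_matrix_le[of v "transpose M ** M"] by (simp add: inner_gram)
    then show "norm (M *v v) \<le> sqrt (spectral_norm (transpose M ** M)) * norm v"
      using real_le_rsqrt by (fastforce simp: real_sqrt_mult)
  qed
  then show ?thesis
    by (metis power_mono real_sqrt_pow2 spectral_norm_nonneg)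
qed

text \<open>
  The spectral norm acts on each column. Bounding only one factor of a product by its Frobenius norm is what
  avoids superfluous factors \<open>sqrt n\<close>.
\<close>

lemma norm_mult_le_left: "norm (M ** P) \<le> spectral_norm M * norm P"
  for M :: "real^'n^'m" and P :: "real^'k^'n"
proof -
  have col: "transpose (M ** P) $ j = M *v (transpose P $ j)" for j
    by (simp add: vec_eq_iff transpose_def matrix_matrix_mult_def matrix_vector_mult_def)
  have "(norm (transpose (M ** P)))\<^sup>2 \<le> (\<Sum>j\<in>UNIV. (spectral_norm M)\<^sup>2 * (norm (transpose P $ j))\<^sup>2)"
    unfolding norm_matrix_power2[of "transpose (M ** P)"] col power_mult_distrib[symmetric]
    by (intro sum_mono power_mono norm_matrix_vector_le) simp
  also have "\<dots> = (spectral_norm M * norm (transpose P))\<^sup>2"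
    by (simp add: norm_matrix_power2[of "transpose P"] power_mult_distrib sum_distrib_left)
  finally show ?thesis
    unfolding norm_transpose by (rule power2_le_imp_le) simp
qed

lemma norm_mult_le_right: "norm (M ** P) \<le> norm M * spectral_norm P"
  for M :: "real^'n^'m" and P :: "real^'k^'n"
  using norm_mult_le_left[of "transpose P" "transpose M"]
  by (simp add: matrix_transpose_mul[symmetric] norm_transpose mult.commute)

lemma spectral_norm_le_norm: "spectral_norm M \<le> norm M" for M :: "real^'n^'m"
proof (rule spectral_norm_le)
  fix v
  have "(norm (M *v v))\<^sup>2 = (\<Sum>i\<in>UNIV. (M $ i \<bullet> v)\<^sup>2)"
    unfolding power2_norm_eq_inner by (simp add: inner_vec_def matrix_vector_mult_def power2_eq_square)
  also have "\<dots> \<le> (\<Sum>i\<in>UNIV. (norm (M $ i) * norm v)\<^sup>2)"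
    by (intro sum_mono) (metis Cauchy_Schwarz_ineq2 abs_ge_zero power2_abs power_mono)
  also have "\<dots> = (norm M * norm v)\<^sup>2"
    by (simp add: norm_matrix_power2 power_mult_distrib sum_distrib_right)
  finally show "norm (M *v v) \<le> norm M * norm v" by (rule power2_le_imp_le) simp
qed

lemma norm_mult_le: "norm (M ** P) \<le> norm M * norm P"
  for M :: "real^'n^'m" and P :: "real^'k^'n"
  using norm_mult_le_left[of M P] spectral_norm_le_norm[of M]
  by (meson mult_right_mono norm_ge_zero order_trans)

lemma norm_mat_1: "norm (mat 1 :: real^'n^'n) = sqrt CARD('n)"
proof -
  have "(norm (mat 1 :: real^'n^'n))\<^sup>2 = (\<Sum>i\<in>(UNIV::'n set). \<Sum>j\<in>(UNIV::'n set). if i = j then 1 else 0)"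
    unfolding power2_norm_eq_inner inner_vec_def
    by (intro sum.cong refl) (simp add: mat_def)
  also have "\<dots> = CARD('n)" by simp
  finally show ?thesis using real_sqrt_unique by fastforce
qed

text \<open>
  The factor is the Frobenius norm of the identity matrix, since \<open>M = M I\<close>.
\<close>

lemma norm_le_sqrt_spectral_norm: "norm M \<le> sqrt CARD('n) * spectral_norm M" for M :: "real^'n^'m"
  using norm_mult_le_left[of M "mat 1 :: real^'n^'n"] by (simp add: norm_mat_1 mult.commute)

lemma mat_mult_vec: "mat s *v v = s *\<^sub>R v" for v :: "real^'n"
  by (simp add: vec_eq_iff matrix_vector_mult_def mat_def if_distrib[of "\<lambda>x. x * _"] cong: if_cong)

lemma spectral_norm_mat: "spectral_norm (mat s :: real^'n^'n) \<le> \<bar>s\<bar>"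
  by (rule spectral_norm_le) (simp add: mat_mult_vec)

section \<open>Extreme eigenvalues and a factor of a positive definite matrix\<close>

lemma matrix_inv_mult:
  fixes M :: "real^'n^'n"
  assumes "invertible M"
  shows "matrix_inv M ** M = mat 1" "M ** matrix_inv M = mat 1"
proof -
  have "M ** matrix_inv M = mat 1 \<and> matrix_inv M ** M = mat 1"
    using assms unfolding invertible_def matrix_inv_def by (rule someI_ex)
  then show "matrix_inv M ** M = mat 1" "M ** matrix_inv M = mat 1" by auto
qed

lemma inner_symmetric_matrix:
  fixes M :: "real^'n^'n"
  assumes "transpose M = M"
  shows "v \<bullet> (M *v w) = (M *v v) \<bullet> w"
  using inner_transpose[of v M w] unfolding assms .

text \<open>
  The form \<open>w \<bullet> M w\<close> attains its minimum over the unit sphere by compactness, and a minimizer is an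
  eigenvector.
\<close>

lemma rayleigh_minimum:
  fixes M :: "real^'n^'n"
  assumes sym: "transpose M = M"
  obtains v l where "norm v = 1" "M *v v = l *\<^sub>R v" "\<And>w. l * (norm w)\<^sup>2 \<le> w \<bullet> (M *v w)"
proof -
  let ?q = "\<lambda>w. w \<bullet> (M *v w)"
  obtain e :: "real^'n" where "norm e = 1"
    using vector_choose_size[of 1] by auto
  then have "sphere (0 :: real^'n) 1 \<noteq> {}" by force
  moreover have "continuous_on (sphere 0 1) ?q"
    by (intro continuous_intros matrix_vector_mult_linear_continuous_on)
  ultimately obtain v where v: "v \<in> sphere 0 1" and vmin: "\<And>w. w \<in> sphere 0 1 \<Longrightarrow> ?q v \<le> ?q w"
    using continuous_attains_inf[of "sphere 0 1" ?q] by auto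
  define l where "l = ?q v"
  have lower: "l * (norm w)\<^sup>2 \<le> ?q w" for w
  proof (cases "w = 0")
    case False
    then have "l \<le> ?q ((1 / norm w) *\<^sub>R w)" unfolding l_def by (intro vmin) simp
    then show ?thesis
      using False by (simp add: matrix_vector_mult_scaleR field_simps power2_eq_square)
  qed simp
  define g where "g = M *v v - l *\<^sub>R v"
  have "g = 0"
  proof (rule ccontr)
    assume "g \<noteq> 0"
    define c where "c = ?q g - l * (norm g)\<^sup>2"
    have nv: "v \<bullet> v = 1" using v by (simp add: norm_eq_1)
    have gg: "g \<bullet> (M *v v) = l * (g \<bullet> v) + (norm g)\<^sup>2"
      unfolding power2_norm_eq_inner g_def by (simp add: inner_diff_right inner_diff_left algebra_simps)
    have gv: "v \<bullet> (M *v g) = g \<bullet> (M *v v)"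
      using inner_symmetric_matrix[OF sym, of v g] by (simp add: inner_commute)
    \<comment> \<open>The form \<open>w \<bullet> M w - l \<parallel>w\<parallel>\<^sup>2\<close> is nonnegative and vanishes at \<open>v\<close>; moving from \<open>v\<close> against its
      gradient \<open>2 g\<close> makes it negative.\<close>
    have quad: "0 \<le> t * (t * c - 2 * (norm g)\<^sup>2)" for t
    proof -
      have "l * (norm (v - t *\<^sub>R g))\<^sup>2 \<le> ?q (v - t *\<^sub>R g)" by (rule lower)
      moreover have "(norm (v - t *\<^sub>R g))\<^sup>2 = 1 - 2 * t * (g \<bullet> v) + t * t * (norm g)\<^sup>2"
        unfolding power2_norm_eq_inner
        by (simp add: inner_diff_left inner_diff_right nv inner_commute algebra_simps)
      moreover have "?q (v - t *\<^sub>R g) = l - 2 * t * (g \<bullet> (M *v v)) + t * t * ?q g"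
        by (simp add: matrix_vector_mult_diff_distrib matrix_vector_mult_scaleR
            inner_diff_left inner_diff_right l_def gv algebra_simps)
      ultimately show ?thesis by (simp add: c_def gg algebra_simps)
    qed
    \<comment> \<open>A step length so small that the quadratic term \<open>t\<^sup>2 c\<close> cannot outweigh the linear term.\<close>
    define t where "t = (norm g)\<^sup>2 / (\<bar>c\<bar> + 1)"
    have "0 < (norm g)\<^sup>2" using \<open>g \<noteq> 0\<close> by simp
    then have t: "0 < t" and "t * (\<bar>c\<bar> + 1) = (norm g)\<^sup>2" unfolding t_def by auto
    moreover have "t * c \<le> t * (\<bar>c\<bar> + 1)" using t by (intro mult_left_mono) auto
    ultimately have "t * c - 2 * (norm g)\<^sup>2 < 0" using \<open>0 < (norm g)\<^sup>2\<close> by linarith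
    then show False using quad[of t] t by (simp add: zero_le_mult_iff)
  qed
  then show thesis using that[of v l] v lower by (simp add: g_def)
qed

lemma lambda_min_ge:
  fixes M :: "real^'n^'n"
  assumes sym: "transpose M = M" and c: "\<And>w. c * (norm w)\<^sup>2 \<le> w \<bullet> (M *v w)"
  shows "c \<le> lambda_min M"
proof -
  obtain v l where v: "norm v = 1" "M *v v = l *\<^sub>R v" and l: "\<And>w. l * (norm w)\<^sup>2 \<le> w \<bullet> (M *v w)"
    using rayleigh_minimum[OF sym] by blast
  have "lambda_min M = l"
    unfolding lambda_min_def
  proof (rule Least_equality)
    show "eigenvalue M l" unfolding eigenvalue_def using v by (intro exI[of _ v]) auto
    fix l' assume "eigenvalue M l'"
    then obtain w where "w \<noteq> 0" "M *v w = l' *\<^sub>R w" unfolding eigenvalue_def by blast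
    then show "l \<le> l'" using l[of w] by (simp add: power2_norm_eq_inner)
  qed
  moreover have "c \<le> l" using c[of v] v by (simp add: power2_norm_eq_inner norm_eq_1)
  ultimately show ?thesis by simp
qed

lemma sigma_min_bound:
  fixes M :: "real^'n^'n"
  shows "0 \<le> sigma_min M \<and> sigma_min M * norm w \<le> norm (M *v w)"
proof -
  have "transpose (transpose M ** M) = transpose M ** M" by (simp add: matrix_transpose_mul)
  from rayleigh_minimum[OF this] obtain v l where v: "norm v = 1" "(transpose M ** M) *v v = l *\<^sub>R v"
    and l: "\<And>w. l * (norm w)\<^sup>2 \<le> w \<bullet> ((transpose M ** M) *v w)" by blast
  have "0 \<le> l" using v inner_gram[of v M] by (simp add: norm_eq_1)
  have "sigma_min M = sqrt l"
    unfolding sigma_min_def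
  proof (rule Least_equality)
    show "singular_value M (sqrt l)"
      unfolding singular_value_def eigenvalue_def using v \<open>0 \<le> l\<close> by (auto intro!: exI[of _ v])
    fix s assume "singular_value M s"
    then obtain x where "0 \<le> s" "x \<noteq> 0" "(transpose M ** M) *v x = s\<^sup>2 *\<^sub>R x"
      unfolding singular_value_def eigenvalue_def by blast
    then have "l \<le> s\<^sup>2" using l[of x] by (simp add: power2_norm_eq_inner)
    then show "sqrt l \<le> s" using \<open>0 \<le> s\<close> real_le_lsqrt by blast
  qed
  moreover have "sqrt l * norm w \<le> norm (M *v w)"
  proof (rule power2_le_imp_le)
    show "(sqrt l * norm w)\<^sup>2 \<le> (norm (M *v w))\<^sup>2"
      using l[of w] \<open>0 \<le> l\<close> by (simp add: inner_gram power_mult_distrib)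
  qed simp
  ultimately show ?thesis using \<open>0 \<le> l\<close> by simp
qed

text \<open>
  For the positive semidefinite matrix \<open>A\<^sup>T A\<close> the smallest singular value cannot exceed the smallest
  eigenvalue, because an eigenvector for the latter is stretched by exactly that amount.
\<close>

lemma sigma_min_gram_le:
  fixes A :: "real^'n^'m"
  shows "sigma_min (transpose A ** A) * (norm w)\<^sup>2 \<le> (norm (A *v w))\<^sup>2"
proof -
  let ?M = "transpose A ** A"
  have sym: "transpose ?M = ?M" by (simp add: matrix_transpose_mul)
  obtain v l where v: "norm v = 1" "?M *v v = l *\<^sub>R v" and l: "\<And>w. l * (norm w)\<^sup>2 \<le> w \<bullet> (?M *v w)"
    using rayleigh_minimum[OF sym] by blast
  have "0 \<le> l" using v inner_gram[of v A] by (simp add: norm_eq_1)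
  then have "sigma_min ?M \<le> l" using sigma_min_bound[of ?M v] v by simp
  then show ?thesis using l[of w] by (metis inner_gram mult_right_mono order_trans zero_le_power2)
qed

text \<open>
  A basis that is orthonormal for the inner product \<open>x \<bullet> B y\<close> exists, by adding one vector at a time: fewer
  than \<open>m\<close> vectors \<open>B f\<^sub>i\<close> leave a nonzero vector orthogonal to all of them. If the basis forms the columns of
  \<open>W\<close>, then \<open>W\<^sup>T B W = I\<close>, and \<open>L = W\<^sup>-\<^sup>1\<close>.
\<close>

lemma pos_def_factor:
  fixes B :: "real^'m^'m"
  assumes "pos_def B"
  obtains L :: "real^'m^'m" where "B = transpose L ** L" "invertible L"
proof -
  have sym: "transpose B = B" and pos: "\<And>x. x \<noteq> 0 \<Longrightarrow> 0 < x \<bullet> (B *v x)"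
    using assms unfolding pos_def_def by auto
  have "\<exists>f :: 'm \<Rightarrow> real^'m. \<forall>i\<in>S. \<forall>j\<in>S. f i \<bullet> (B *v f j) = (if i = j then 1 else 0)" if "finite S" for S
    using that
  proof (induction S)
    case (insert a S)
    then obtain f :: "'m \<Rightarrow> real^'m"
      where f: "\<And>i j. i \<in> S \<Longrightarrow> j \<in> S \<Longrightarrow> f i \<bullet> (B *v f j) = (if i = j then 1 else 0)" by blast
    let ?W = "(\<lambda>i. B *v f i) ` S"
    have "card ?W < DIM(real^'m)"
    proof -
      have "card ?W \<le> card S" by (simp add: card_image_le insert.hyps)
      also have "\<dots> < card (insert a S)" using insert.hyps by simp
      also have "\<dots> \<le> CARD('m)" by (rule card_mono) auto
      finally show ?thesis by simp
    qed
    then have "dim ?W < DIM(real^'m)"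
      using dim_le_card'[of ?W] insert.hyps by (meson finite_imageI le_less_trans)
    then obtain x where "x \<noteq> 0" and x: "\<And>y. y \<in> span ?W \<Longrightarrow> orthogonal x y"
      using orthogonal_to_subspace_exists by metis
    have xf: "x \<bullet> (B *v f i) = 0" if "i \<in> S" for i
      using x[of "B *v f i"] that by (auto simp: orthogonal_def intro: span_base)
    define c where "c = sqrt (x \<bullet> (B *v x))"
    have c: "0 < c" "c * c = x \<bullet> (B *v x)" using pos[OF \<open>x \<noteq> 0\<close>] by (auto simp: c_def)
    define g where "g = f(a := (1 / c) *\<^sub>R x)"
    have "g i \<bullet> (B *v g j) = (if i = j then 1 else 0)" if "i \<in> insert a S" "j \<in> insert a S" for i j
    proof -
      have "f i \<bullet> (B *v x) = 0" if "i \<in> S" for i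
        using xf[OF that] inner_symmetric_matrix[OF sym, of "f i" x] by (simp add: inner_commute)
      then show ?thesis
        using that xf f c insert.hyps by (auto simp: g_def matrix_vector_mult_scaleR)
    qed
    then show ?case by blast
  qed auto
  then obtain f :: "'m \<Rightarrow> real^'m" where f: "\<And>i j. f i \<bullet> (B *v f j) = (if i = j then 1 else 0)"
    by (metis UNIV_I finite_class.finite_UNIV)
  define W where "W = transpose (vec_lambda f)"
  have "transpose W ** (B ** W) = mat 1"
  proof -
    have "(transpose W ** (B ** W)) $ i $ j = f i \<bullet> (B *v f j)" for i j
      by (simp add: W_def transpose_def matrix_matrix_mult_def matrix_vector_mult_def inner_vec_def)
    then show ?thesis by (simp add: vec_eq_iff mat_def f)
  qed
  then have W: "invertible W"
    unfolding invertible_left_inverse by (auto simp: matrix_mul_assoc)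
  define L where "L = matrix_inv W"
  have LW: "L ** W = mat 1" "W ** L = mat 1"
    unfolding L_def using matrix_inv_mult[OF W] by simp_all
  have TL: "transpose L ** transpose W = mat 1" by (metis LW(2) matrix_transpose_mul transpose_mat)
  have "B = transpose L ** (transpose W ** (B ** W)) ** L"
    by (metis LW(2) TL matrix_mul_assoc matrix_mul_lid matrix_mul_rid)
  then have "B = transpose L ** L"
    using \<open>transpose W ** (B ** W) = mat 1\<close> by simp
  moreover have "invertible L" using LW invertible_def by blast
  ultimately show thesis using that by blast
qed

lemma spectral_norm_le_sqrt_gram:
  fixes L :: "real^'m^'m"
  shows "spectral_norm L \<le> sqrt (spectral_norm (transpose L ** L))"
  by (rule real_le_rsqrt) (rule spectral_norm_power2_le_gram)

text \<open>
  With \<open>J = L\<^sup>-\<^sup>1\<close> the inverse of \<open>L\<^sup>T L\<close> is \<open>J J\<^sup>T\<close>, whose spectral norm is the square of that of \<open>J\<close>.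
\<close>

lemma norm_le_inverse_factor:
  fixes L :: "real^'m^'m"
  assumes "invertible L"
  shows "norm v \<le> sqrt (spectral_norm (matrix_inv (transpose L ** L))) * norm (L *v v)"
proof -
  let ?J = "matrix_inv L" and ?B = "transpose L ** L"
  have J: "?J ** L = mat 1" "L ** ?J = mat 1" using matrix_inv_mult[OF assms] by simp_all
  have tJ: "transpose L ** transpose ?J = mat 1" by (metis J(1) matrix_transpose_mul transpose_mat)
  have "?B ** (?J ** transpose ?J) = mat 1"
    by (metis J(2) tJ matrix_mul_assoc matrix_mul_rid)
  moreover from this have "invertible ?B" using invertible_right_inverse by blast
  ultimately have inv: "matrix_inv ?B = ?J ** transpose ?J"
    by (metis matrix_inv_mult(1) matrix_mul_assoc matrix_mul_lid matrix_mul_rid)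
  have "spectral_norm (transpose ?J) \<le> sqrt (spectral_norm (?J ** transpose ?J))"
    using spectral_norm_le_sqrt_gram[of "transpose ?J"] by simp
  then have "spectral_norm ?J \<le> sqrt (spectral_norm (matrix_inv ?B))" by (simp add: inv)
  moreover have "norm v \<le> spectral_norm ?J * norm (L *v v)"
    using norm_matrix_vector_le[of ?J "L *v v"] by (simp add: matrix_vector_mul_assoc J)
  ultimately show ?thesis by (meson mult_right_mono norm_ge_zero order_trans)
qed

section \<open>Rounding errors of the elementary operations\<close>

text \<open>
  The threshold \<open>1 / 80\<close> is what the smallness hypothesis on \<open>u\<close> provides for every multiple of \<open>u\<close> that occurs.
\<close>

lemma gamma_fl_bounds:
  assumes "0 < u" "real k * u \<le> 1 / 80"
  shows "0 \<le> gamma_fl u k" "gamma_fl u k \<le> 102 / 100 * real k * u"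
proof -
  have d: "79 / 80 \<le> 1 - real k * u" using assms by simp
  then show "0 \<le> gamma_fl u k" unfolding gamma_fl_def using assms by simp
  have "(real k * u) / (1 - real k * u) \<le> (real k * u) / (79 / 80)"
    using d assms by (intro divide_left_mono) auto
  also have "\<dots> \<le> 102 / 100 * real k * u" using assms by (simp add: mult_right_mono)
  finally show "gamma_fl u k \<le> 102 / 100 * real k * u" unfolding gamma_fl_def .
qed

lemma closed_segment_square_le:
  fixes x :: real
  assumes "x \<in> closed_segment p q"
  shows "(x - s)\<^sup>2 \<le> (p - s)\<^sup>2 + (q - s)\<^sup>2"
proof -
  have "\<bar>x - s\<bar> \<le> \<bar>p - s\<bar> \<or> \<bar>x - s\<bar> \<le> \<bar>q - s\<bar>"
    using assms by (auto simp: closed_segment_eq_real_ivl split: if_splits)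
  then show ?thesis
    by (metis abs_le_square_iff add_increasing add_increasing2 zero_le_power2)
qed

text \<open>
  A pair of mirrored entries of \<open>G\<close> inherits at worst the larger of the two errors twice, and twice the larger
  square is at most twice the sum of the squares.
\<close>

lemma norm_symmetrization_error_le:
  fixes G P S :: "real^'n^'n"
  assumes seg: "\<And>i j. G $ i $ j \<in> closed_segment (P $ i $ j) (P $ j $ i)" and S: "transpose S = S"
  shows "norm (G - S) \<le> sqrt 2 * norm (P - S)"
proof (rule power2_le_imp_le)
  have sq: "(norm M)\<^sup>2 = (\<Sum>i\<in>UNIV. \<Sum>j\<in>UNIV. (M $ i $ j)\<^sup>2)" for M :: "real^'n^'n"
    unfolding power2_norm_eq_inner by (simp add: inner_vec_def power2_eq_square)
  have Sij: "S $ j $ i = S $ i $ j" for i j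
    using S by (metis transpose_def vec_lambda_beta)
  have "(norm (G - S))\<^sup>2
      \<le> (\<Sum>i\<in>UNIV. \<Sum>j\<in>UNIV. ((P - S) $ i $ j)\<^sup>2 + (transpose (P - S) $ i $ j)\<^sup>2)"
    unfolding sq by (intro sum_mono) (simp add: transpose_def Sij closed_segment_square_le seg)
  also have "\<dots> = (norm (P - S))\<^sup>2 + (norm (transpose (P - S)))\<^sup>2"
    by (simp add: sq sum.distrib)
  finally show "(norm (G - S))\<^sup>2 \<le> (sqrt 2 * norm (P - S))\<^sup>2"
    by (simp add: norm_transpose power_mult_distrib)
qed simp

lemma matrix_diff_ldistrib: "M ** (P - R) = M ** P - M ** R"
  for M :: "real^'n^'m" and P R :: "real^'k^'n"
  by (simp add: vec_eq_iff matrix_matrix_mult_def right_diff_distrib sum_subtractf)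

lemma matrix_diff_rdistrib: "(M - P) ** R = M ** R - P ** R"
  for M P :: "real^'n^'m" and R :: "real^'k^'n"
  by (simp add: vec_eq_iff matrix_matrix_mult_def left_diff_distrib sum_subtractf)

lemma fl_gram_spectral_error:
  fixes B :: "real^'m^'m" and Y :: "real^'n^'m"
  assumes "fl_gram u B Y G"
  shows "spectral_norm (G - transpose Y ** B ** Y)
    \<le> 22 / 10 * (real CARD('m) * sqrt (real CARD('m) * real CARD('n)) * u) * ((spectral_norm Y)\<^sup>2 * spectral_norm B)"
  using assms unfolding fl_gram_def by (simp add: mult_ac)

text \<open>
  The error of \<open>P\<close> splits into \<open>(P - Y\<^sup>T C) + Y\<^sup>T (C - B Y)\<close>. Absolute values cost a factor \<open>sqrt m\<close> for \<open>B\<close> and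
  \<open>sqrt n\<close> for each \<open>Y\<close> inside them, but in the second term the left factor \<open>Y\<^sup>T\<close> stands outside and costs only
  its spectral norm. So both terms are of order \<open>m sqrt (m n) u\<close>, whereas bounding
  \<open>\<bar>Y\<bar>\<^sup>T \<bar>B\<bar> \<bar>Y\<bar>\<close> as a whole would give \<open>m n sqrt m u\<close>.
\<close>

lemma fl_gram_norm_error:
  fixes B :: "real^'m^'m" and Y :: "real^'n^'m"
  assumes fl: "fl_gram u B Y G" and "transpose B = B" and nm: "CARD('n) \<le> CARD('m)"
    and u: "0 < u" "real CARD('m) * sqrt (real CARD('m) * real CARD('n)) * u \<le> 1 / 80"
  shows "norm (G - transpose Y ** B ** Y)
    \<le> 295 / 100 * (real CARD('m) * sqrt (real CARD('m) * real CARD('n)) * u) * ((spectral_norm Y)\<^sup>2 * spectral_norm B)"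
proof -
  define m n where "m = real CARD('m)" and "n = real CARD('n)"
  define y b g where "y = spectral_norm Y" and "b = spectral_norm B" and "g = gamma_fl u CARD('m)"
  have mn: "1 \<le> n" "n \<le> m" using nm by (simp_all add: m_def n_def Suc_leI)
  have pos: "0 \<le> y" "0 \<le> b" by (simp_all add: y_def b_def)
  define q where "q = sqrt (m * n)"
  have q_eq: "q = sqrt m * sqrt n" by (simp add: q_def real_sqrt_mult)
  have "n * n \<le> m * n" using mn by (intro mult_right_mono) auto
  then have nq: "n \<le> q" unfolding q_def by (simp add: real_le_rsqrt power2_eq_square)
  have "m \<le> m * n" using mn by simp
  then have mq: "sqrt m \<le> q" unfolding q_def by simp
  have u80: "m * q * u \<le> 1 / 80" using u(2) by (simp add: m_def n_def q_def)
  have "m * 1 * u \<le> m * q * u" using mn nq u(1) by (intro mult_right_mono mult_left_mono) auto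
  then have "m * u \<le> 1 / 80" using u80 by simp
  then have g: "0 \<le> g" "g \<le> 102 / 100 * m * u"
    using gamma_fl_bounds[OF u(1), of "CARD('m)"] by (simp_all add: g_def m_def)
  obtain C P where C: "\<bar>C - B ** Y\<bar> \<le> g *\<^sub>R (\<bar>B\<bar> ** \<bar>Y\<bar>)"
    and P: "\<bar>P - transpose Y ** C\<bar> \<le> g *\<^sub>R (transpose \<bar>Y\<bar> ** \<bar>C\<bar>)"
    and seg: "\<And>i j. G $ i $ j \<in> closed_segment (P $ i $ j) (P $ j $ i)"
    using fl unfolding fl_gram_def g_def by blast
  have Yn: "norm Y \<le> sqrt n * y" and Bn: "norm B \<le> sqrt m * b"
    using norm_le_sqrt_spectral_norm[of Y] norm_le_sqrt_spectral_norm[of B]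
    by (simp_all add: m_def n_def y_def b_def)
  have "norm (C - B ** Y) \<le> g * norm (\<bar>B\<bar> ** \<bar>Y\<bar>)"
    using norm_entrywise_mono[OF C] g by simp
  also have "\<dots> \<le> g * ((sqrt m * b) * (sqrt n * y))"
    using norm_mult_le[of "\<bar>B\<bar>" "\<bar>Y\<bar>"] Yn Bn g pos mn
    by (intro mult_left_mono order_trans[OF norm_mult_le] mult_mono) (auto simp: norm_abs_matrix)
  finally have EC: "norm (C - B ** Y) \<le> g * q * (b * y)" by (simp add: q_eq mult_ac)
  have "norm (B ** Y) \<le> b * (sqrt n * y)"
    unfolding b_def by (rule order_trans[OF norm_mult_le_left]) (simp add: Yn mult_left_mono)
  moreover have "g * q * (b * y) \<le> 2 / 100 * (sqrt n * (b * y))"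
  proof -
    have "g * q \<le> 102 / 100 * m * u * q" using g nq mn by (intro mult_right_mono) auto
    also have "\<dots> \<le> 2 / 100 * 1" using u80 by (simp add: mult_ac)
    also have "\<dots> \<le> 2 / 100 * sqrt n" using mn by (intro mult_left_mono) auto
    finally have "(g * q) * (b * y) \<le> (2 / 100 * sqrt n) * (b * y)"
      using pos by (intro mult_right_mono) auto
    then show ?thesis by (simp add: mult_ac)
  qed
  moreover have "norm C \<le> norm (B ** Y) + norm (C - B ** Y)"
    using norm_triangle_ineq[of "B ** Y" "C - B ** Y"] by simp
  ultimately have Cn: "norm C \<le> 102 / 100 * sqrt n * (b * y)" using EC by (simp add: mult_ac)
  have "norm (P - transpose Y ** C) \<le> g * norm (transpose \<bar>Y\<bar> ** \<bar>C\<bar>)"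
    using norm_entrywise_mono[OF P] g by simp
  also have "\<dots> \<le> g * ((sqrt n * y) * (102 / 100 * sqrt n * (b * y)))"
    using Yn Cn g pos mn
    by (intro mult_left_mono order_trans[OF norm_mult_le] mult_mono)
      (auto simp: norm_abs_matrix norm_transpose)
  also have "\<dots> = 102 / 100 * g * (sqrt n * sqrt n) * (y\<^sup>2 * b)" by (simp add: power2_eq_square mult_ac)
  also have "\<dots> \<le> 102 / 100 * g * q * (y\<^sup>2 * b)"
    using mn nq g pos by (intro mult_right_mono mult_left_mono) auto
  finally have EP: "norm (P - transpose Y ** C) \<le> 102 / 100 * g * q * (y\<^sup>2 * b)" .
  have "norm (transpose Y ** (C - B ** Y)) \<le> y * (g * q * (b * y))"
    using norm_mult_le_left[of "transpose Y" "C - B ** Y"] EC pos(1)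
    unfolding spectral_norm_transpose y_def[symmetric] by (meson mult_left_mono order_trans)
  moreover have "P - transpose Y ** B ** Y = (P - transpose Y ** C) + transpose Y ** (C - B ** Y)"
    by (simp add: matrix_diff_ldistrib matrix_mul_assoc)
  ultimately have "norm (P - transpose Y ** B ** Y) \<le> 202 / 100 * g * q * (y\<^sup>2 * b)"
    using norm_triangle_ineq[of "P - transpose Y ** C" "transpose Y ** (C - B ** Y)"] EP
    by (simp only:) (simp add: power2_eq_square mult_ac)
  moreover have "norm (G - transpose Y ** B ** Y) \<le> sqrt 2 * norm (P - transpose Y ** B ** Y)"
    by (rule norm_symmetrization_error_le[OF seg])
      (simp add: matrix_transpose_mul \<open>transpose B = B\<close> matrix_mul_assoc)
  moreover have "sqrt 2 \<le> 1415 / 1000" by (rule real_le_lsqrt) (auto simp: power2_eq_square)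
  ultimately have "norm (G - transpose Y ** B ** Y) \<le> 1415 / 1000 * (202 / 100 * g * q * (y\<^sup>2 * b))"
    by (smt (verit) mult_mono norm_ge_zero real_sqrt_ge_zero)
  also have "\<dots> = 28583 / 10000 * (q * (y\<^sup>2 * b)) * g" by simp
  also have "\<dots> \<le> 28583 / 10000 * (q * (y\<^sup>2 * b)) * (102 / 100 * m * u)"
    using g mn nq pos by (intro mult_left_mono) auto
  also have "\<dots> = 2915466 / 1000000 * (m * q * u * (y\<^sup>2 * b))" by (simp add: mult_ac)
  also have "\<dots> \<le> 295 / 100 * (m * q * u * (y\<^sup>2 * b))"
    using mn nq u(1) pos by (intro mult_right_mono) auto
  finally show ?thesis by (simp add: m_def n_def q_def y_def b_def mult_ac)
qed

lemma fl_chol_factor: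
  assumes "fl_chol u H (Some T)"
  shows "upper_triangular T" "invertible T"
  using assms by (auto elim: fl_chol.cases)

text \<open>
  The entrywise error bound is relative to \<open>\<bar>T\<bar>\<^sup>T \<bar>T\<bar>\<close>, whose Frobenius norm is at most \<open>n \<parallel>T\<parallel>\<^sup>2\<close>; and \<open>\<parallel>T\<parallel>\<^sup>2\<close>
  is in turn bounded by \<open>\<parallel>H\<parallel>\<close> plus this very error, so the error can be absorbed.
\<close>

lemma fl_chol_success_bounds:
  fixes H T :: "real^'n::{finite,linorder}^'n::{finite,linorder}"
  assumes T: "\<bar>transpose T ** T - H\<bar> \<le> gamma_fl u (CARD('n) + 1) *\<^sub>R (transpose \<bar>T\<bar> ** \<bar>T\<bar>)"
    and h: "spectral_norm H \<le> h"
    and u: "0 < u" "real CARD('n) * (real CARD('n) + 1) * u \<le> 1 / 80"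
  shows "(spectral_norm T)\<^sup>2 \<le> 103 / 100 * h"
    and "norm (transpose T ** T - H) \<le> 106 / 100 * (real CARD('n) * (real CARD('n) + 1) * u) * h"
proof -
  define n where "n = real CARD('n)"
  define t where "t = (spectral_norm T)\<^sup>2"
  have n: "1 \<le> n" by (simp add: n_def Suc_leI)
  have u80: "n * (n + 1) * u \<le> 1 / 80" using u(2) by (simp add: n_def)
  have "1 * (n + 1) * u \<le> n * (n + 1) * u" using n u(1) by (intro mult_right_mono) auto
  then have "(n + 1) * u \<le> 1 / 80" using u80 by simp
  then have g: "0 \<le> gamma_fl u (CARD('n) + 1)" "gamma_fl u (CARD('n) + 1) \<le> 102 / 100 * (n + 1) * u"
    using gamma_fl_bounds[OF u(1), of "CARD('n) + 1"] by (simp_all add: n_def add.commute)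
  let ?e = "norm (transpose T ** T - H)"
  have "?e \<le> gamma_fl u (CARD('n) + 1) * norm (transpose \<bar>T\<bar> ** \<bar>T\<bar>)"
    using norm_entrywise_mono[OF T] g by simp
  also have "\<dots> \<le> (102 / 100 * (n + 1) * u) * ((sqrt n * spectral_norm T) * (sqrt n * spectral_norm T))"
    using norm_le_sqrt_spectral_norm[of T] g n u(1)
    by (intro mult_mono order_trans[OF norm_mult_le]) (auto simp: norm_abs_matrix norm_transpose n_def)
  also have "\<dots> = 102 / 100 * (n + 1) * u * (sqrt n * sqrt n) * t" by (simp add: t_def power2_eq_square)
  also have "\<dots> = 102 / 100 * (n * (n + 1) * u) * t" using n by simp
  finally have e: "?e \<le> 102 / 100 * (n * (n + 1) * u) * t" .
  have "102 / 100 * (n * (n + 1) * u) * t \<le> 102 / 100 * (1 / 80) * t"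
    using u80 by (intro mult_right_mono mult_left_mono) (auto simp: t_def)
  moreover have "t \<le> spectral_norm (transpose T ** T)"
    unfolding t_def by (rule spectral_norm_power2_le_gram)
  moreover have "spectral_norm (transpose T ** T) \<le> spectral_norm H + ?e"
    using spectral_norm_add_le[of H "transpose T ** T - H"] spectral_norm_le_norm[of "transpose T ** T - H"]
    by simp
  moreover have "0 \<le> h" using h spectral_norm_nonneg order_trans by blast
  ultimately have t: "t \<le> 103 / 100 * h" using e h by linarith
  then show "(spectral_norm T)\<^sup>2 \<le> 103 / 100 * h" unfolding t_def .
  have "0 \<le> h" using h spectral_norm_nonneg order_trans by blast
  have "102 / 100 * (n * (n + 1) * u) * t \<le> 102 / 100 * (n * (n + 1) * u) * (103 / 100 * h)"
    using t n u(1) by (intro mult_left_mono) auto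
  also have "\<dots> = 10506 / 10000 * (n * (n + 1) * u * h)" by simp
  also have "\<dots> \<le> 106 / 100 * (n * (n + 1) * u * h)"
    using n u(1) \<open>0 \<le> h\<close> by (intro mult_right_mono) auto
  finally have "?e \<le> 106 / 100 * (n * (n + 1) * u * h)" using e by linarith
  then show "?e \<le> 106 / 100 * (real CARD('n) * (real CARD('n) + 1) * u) * h"
    by (simp add: n_def mult_ac)
qed

text \<open>
  Each of the \<open>n\<close> terms of the sum in the success criterion is at most \<open>1.05 (n + 1) u\<close>, so it suffices that the
  quadratic form of \<open>H\<close> stays above \<open>1.05 n (n + 1) u \<parallel>H\<parallel>\<close> on the unit sphere.
\<close>

lemma fl_chol_no_breakdown:
  fixes H :: "real^'n::{finite,linorder}^'n::{finite,linorder}"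
  assumes sym: "transpose H = H" and h: "spectral_norm H \<le> h"
    and c: "\<And>w. c * (norm w)\<^sup>2 \<le> w \<bullet> (H *v w)" "0 < c"
    and u: "0 < u" "real CARD('n) * (real CARD('n) + 1) * u \<le> 1 / 80"
    and hc: "105 / 100 * (real CARD('n) * (real CARD('n) + 1) * u) * h \<le> c"
  shows "\<not> fl_chol u H None"
proof
  assume "fl_chol u H None"
  then have bad: "\<not> (pos_def H \<and>
            (\<Sum>i = 1..CARD('n). gamma_fl u (i + 1) / (1 - gamma_fl u (i + 1))) * spectral_norm H
              \<le> lambda_min H)" by cases auto
  have "0 < w \<bullet> (H *v w)" if "w \<noteq> 0" for w
    using c(1)[of w] mult_pos_pos[OF c(2), of "(norm w)\<^sup>2"] that by simp
  then have pd: "pos_def H" using sym unfolding pos_def_def by blast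
  define n where "n = real CARD('n)"
  have n: "1 \<le> n" by (simp add: n_def Suc_leI)
  have "1 * (n + 1) * u \<le> n * (n + 1) * u" using n u(1) by (intro mult_right_mono) auto
  then have n1: "(n + 1) * u \<le> 1 / 80" using u(2) unfolding n_def by linarith
  have term_le: "gamma_fl u (i + 1) / (1 - gamma_fl u (i + 1)) \<le> 105 / 100 * ((n + 1) * u)"
    if "i \<in> {1..CARD('n)}" for i
  proof -
    have iu: "real (i + 1) * u \<le> (n + 1) * u"
      using that u(1) unfolding n_def by (intro mult_right_mono) auto
    then have g: "0 \<le> gamma_fl u (i + 1)" "gamma_fl u (i + 1) \<le> 102 / 100 * real (i + 1) * u"
      using gamma_fl_bounds[OF u(1), of "i + 1"] n1 by linarith+
    then have g2: "gamma_fl u (i + 1) \<le> 102 / 100 * ((n + 1) * u)" using iu by linarith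
    then have "gamma_fl u (i + 1) \<le> 2 / 100" using n1 by linarith
    then have "gamma_fl u (i + 1) / (1 - gamma_fl u (i + 1)) \<le> gamma_fl u (i + 1) / (98 / 100)"
      using g by (intro divide_left_mono) auto
    also have "\<dots> \<le> 105 / 100 * ((n + 1) * u)" using g g2 n u(1) by simp
    finally show ?thesis .
  qed
  have "(\<Sum>i = 1..CARD('n). gamma_fl u (i + 1) / (1 - gamma_fl u (i + 1))) \<le> n * (105 / 100 * ((n + 1) * u))"
    using sum_bounded_above[of "{1..CARD('n)}", OF term_le] by (simp add: n_def)
  then have "(\<Sum>i = 1..CARD('n). gamma_fl u (i + 1) / (1 - gamma_fl u (i + 1))) * spectral_norm H
      \<le> n * (105 / 100 * ((n + 1) * u)) * h"
    using h n u(1) by (intro mult_mono) auto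
  also have "\<dots> \<le> c" using hc by (simp add: n_def mult_ac)
  also have "\<dots> \<le> lambda_min H" by (rule lambda_min_ge[OF sym c(1)])
  finally show False using bad pd by blast
qed

lemma matrix_mult_nth: "(M ** P) $ i $ j = (\<Sum>k\<in>UNIV. M $ i $ k * P $ k $ j)"
  by (simp add: matrix_matrix_mult_def)

lemma real_card_mult_le:
  assumes "0 < u" "real n * (real n + 1) * u \<le> 1 / 80" "0 < n"
  shows "real n * u \<le> 1 / 80"
proof -
  have "real n * 1 * u \<le> real n * (real n + 1) * u"
    using assms by (intro mult_right_mono mult_left_mono) auto
  then show ?thesis using assms(2) by linarith
qed

text \<open>
  Each factor pays \<open>sqrt n\<close> for its absolute values, which turns \<open>n u\<close> into \<open>n\<^sup>2 u\<close>.
\<close>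

lemma gamma_norm_mult_norm_le:
  fixes S :: "real^'n^'m" and T :: "real^'n^'n"
  assumes u: "0 < u" "real CARD('n) * (real CARD('n) + 1) * u \<le> 1 / 80"
  shows "gamma_fl u CARD('n) * norm (\<bar>S\<bar> ** \<bar>T\<bar>)
    \<le> 102 / 100 * ((real CARD('n))\<^sup>2 * u) * (spectral_norm S * spectral_norm T)"
proof -
  define n where "n = real CARD('n)"
  have n: "1 \<le> n" by (simp add: n_def Suc_leI)
  have g: "0 \<le> gamma_fl u CARD('n)" "gamma_fl u CARD('n) \<le> 102 / 100 * n * u"
    using gamma_fl_bounds[OF u(1) real_card_mult_le[OF u]] by (simp_all add: n_def)
  have "gamma_fl u CARD('n) * norm (\<bar>S\<bar> ** \<bar>T\<bar>)
      \<le> (102 / 100 * n * u) * ((sqrt n * spectral_norm S) * (sqrt n * spectral_norm T))"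
    using g n norm_le_sqrt_spectral_norm[of S] norm_le_sqrt_spectral_norm[of T] u(1)
    by (intro mult_mono order_trans[OF norm_mult_le]) (auto simp: norm_abs_matrix n_def)
  also have "\<dots> = 102 / 100 * n * u * (sqrt n * sqrt n) * (spectral_norm S * spectral_norm T)" by simp
  also have "\<dots> = 102 / 100 * (n\<^sup>2 * u) * (spectral_norm S * spectral_norm T)"
    using n by (simp add: power2_eq_square)
  finally show ?thesis by (simp add: n_def)
qed

text \<open>
  The perturbations of \<open>T\<close> differ from row to row, but in the residual they only appear through the common
  entrywise bound \<open>\<bar>Z\<bar> \<bar>T\<bar>\<close>.
\<close>

lemma fl_solve_residual:
  fixes Y Z :: "real^'n^'m" and T :: "real^'n^'n"
  assumes fl: "fl_solve u Y T Z"
    and u: "0 < u" "real CARD('n) * (real CARD('n) + 1) * u \<le> 1 / 80"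
  shows "norm (Z ** T - Y) \<le> 102 / 100 * ((real CARD('n))\<^sup>2 * u) * (spectral_norm Z * spectral_norm T)"
proof -
  let ?g = "gamma_fl u CARD('n)"
  have g: "0 \<le> ?g" using gamma_fl_bounds[OF u(1) real_card_mult_le[OF u]] by simp
  have "\<bar>(Z ** T - Y) $ i $ j\<bar> \<le> ?g * (\<bar>Z\<bar> ** \<bar>T\<bar>) $ i $ j" for i j
  proof -
    obtain D where D: "\<bar>D\<bar> \<le> ?g *\<^sub>R \<bar>T\<bar>" and eq: "row i Z v* (T + D) = row i Y"
      using fl unfolding fl_solve_def by blast
    have "Y $ i $ j = (\<Sum>k\<in>UNIV. Z $ i $ k * (T $ k $ j + D $ k $ j))"
      using arg_cong[OF eq, of "\<lambda>v. v $ j"]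
      by (simp add: row_def vector_matrix_mult_def mult.commute)
    then have "(Z ** T - Y) $ i $ j = - (\<Sum>k\<in>UNIV. Z $ i $ k * D $ k $ j)"
      by (simp add: matrix_mult_nth distrib_left sum.distrib)
    then have "\<bar>(Z ** T - Y) $ i $ j\<bar> \<le> (\<Sum>k\<in>UNIV. \<bar>Z $ i $ k\<bar> * \<bar>D $ k $ j\<bar>)"
      using sum_abs[of "\<lambda>k. Z $ i $ k * D $ k $ j" UNIV] by (simp add: abs_mult)
    also have "\<dots> \<le> (\<Sum>k\<in>UNIV. \<bar>Z $ i $ k\<bar> * (?g * \<bar>T $ k $ j\<bar>))"
      using D by (intro sum_mono mult_left_mono) (auto simp: less_eq_vec_def abs_vec_def)
    also have "\<dots> = ?g * (\<bar>Z\<bar> ** \<bar>T\<bar>) $ i $ j"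
      by (simp add: matrix_mult_nth abs_vec_def sum_distrib_left mult_ac)
    finally show ?thesis .
  qed
  then have "\<bar>Z ** T - Y\<bar> \<le> ?g *\<^sub>R (\<bar>Z\<bar> ** \<bar>T\<bar>)"
    by (simp add: less_eq_vec_def abs_vec_def)
  from norm_entrywise_mono[OF this] show ?thesis
    using gamma_norm_mult_norm_le[OF u, of Z T] g by simp
qed

lemma fl_mult_error:
  fixes S T P :: "real^'n^'n"
  assumes fl: "fl_mult u S T P"
    and u: "0 < u" "real CARD('n) * (real CARD('n) + 1) * u \<le> 1 / 80"
  shows "norm (P - S ** T) \<le> 102 / 100 * ((real CARD('n))\<^sup>2 * u) * (spectral_norm S * spectral_norm T)"
  using norm_entrywise_mono[of "P - S ** T" "gamma_fl u CARD('n) *\<^sub>R (\<bar>S\<bar> ** \<bar>T\<bar>)"] fl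
    gamma_norm_mult_norm_le[OF u, of S T] gamma_fl_bounds(1)[OF u(1) real_card_mult_le[OF u]]
  unfolding fl_mult_def by simp

lemma upper_triangular_mult:
  assumes "upper_triangular S" "upper_triangular T"
  shows "upper_triangular (S ** T)"
proof -
  have "S $ i $ k * T $ k $ j = 0" if "j < i" for i j k
    using assms that unfolding upper_triangular_def by (cases "k < i") (auto intro: less_le_trans)
  then show ?thesis unfolding upper_triangular_def matrix_mult_nth by (simp add: sum.neutral)
qed

text \<open>
  The error bound vanishes below the diagonal, so the computed product is exactly zero there.
\<close>

lemma fl_mult_upper_triangular:
  assumes fl: "fl_mult u S T P" and "upper_triangular S" "upper_triangular T"
  shows "upper_triangular P"
  unfolding upper_triangular_def
proof (intro allI impI)
  fix i j :: 'a assume "j < i"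
  have "upper_triangular \<bar>S\<bar>" "upper_triangular \<bar>T\<bar>"
    using assms unfolding upper_triangular_def abs_vec_def by auto
  then have "(S ** T) $ i $ j = 0" "(\<bar>S\<bar> ** \<bar>T\<bar>) $ i $ j = 0"
    using upper_triangular_mult[of S T] upper_triangular_mult[of "\<bar>S\<bar>" "\<bar>T\<bar>"] assms \<open>j < i\<close>
    unfolding upper_triangular_def by blast+
  moreover have "\<bar>(P - S ** T) $ i $ j\<bar> \<le> gamma_fl u CARD('a) * (\<bar>S\<bar> ** \<bar>T\<bar>) $ i $ j"
    using fl unfolding fl_mult_def less_eq_vec_def abs_vec_def by simp
  ultimately show "P $ i $ j = 0" by simp
qed

section \<open>Perturbation of one Cholesky QR step\<close>

lemma spectral_norm_matrix_inv_le:
  fixes T :: "real^'n^'n"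
  assumes T: "invertible T" and \<tau>: "0 < \<tau>" "\<And>w. \<tau> * norm w \<le> norm (T *v w)"
  shows "spectral_norm (matrix_inv T) \<le> 1 / \<tau>"
proof (rule spectral_norm_le)
  fix v show "norm (matrix_inv T *v v) \<le> 1 / \<tau> * norm v"
    using \<tau>(2)[of "matrix_inv T *v v"] \<tau>(1)
    by (simp add: matrix_vector_mul_assoc matrix_inv_mult[OF T] field_simps)
qed

lemma spectral_norm_le_mult_left:
  fixes L :: "real^'k^'m" and Z :: "real^'n^'k"
  assumes "\<And>v. norm v \<le> p * norm (L *v v)" "0 \<le> p"
  shows "spectral_norm Z \<le> p * spectral_norm (L ** Z)"
proof (rule spectral_norm_le)
  fix v
  have "norm (Z *v v) \<le> p * norm ((L ** Z) *v v)"
    using assms(1)[of "Z *v v"] by (simp add: matrix_vector_mul_assoc)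
  also have "\<dots> \<le> p * (spectral_norm (L ** Z) * norm v)"
    by (intro mult_left_mono norm_matrix_vector_le assms)
  finally show "norm (Z *v v) \<le> p * spectral_norm (L ** Z) * norm v" by simp
qed

text \<open>
  Here \<open>L Y T\<^sup>-\<^sup>1\<close> is the exact quotient, in the metric of \<open>L\<^sup>T L\<close>, and \<open>D\<close> is the effect of rounding in the
  solves. The residual is proportional to the norm of the unknown \<open>Z\<close> itself; through \<open>l p\<close>, the
  condition number of \<open>L\<close>, this becomes a bound of \<open>D\<close> relative to \<open>L Z = L Y T\<^sup>-\<^sup>1 + D\<close>, which is
  absorbed when \<open>\<eta> < 1\<close>. The comparison of \<open>\<parallel>L Y w\<parallel>\<close> with \<open>\<parallel>T w\<parallel>\<close> carries over to singular values by
  substituting \<open>w = T\<^sup>-\<^sup>1 v\<close>.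
\<close>

lemma triangular_solve_perturbation:
  fixes L :: "real^'m^'m" and Y Z :: "real^'n^'m" and T :: "real^'n^'n"
  defines "J \<equiv> matrix_inv T"
  defines "D \<equiv> L ** (Z ** T - Y) ** J"
  assumes T: "invertible T"
    and l: "spectral_norm L \<le> l" and p: "\<And>v. norm v \<le> p * norm (L *v v)" "0 \<le> p"
    and \<tau>: "0 < \<tau>" "\<And>w. \<tau> * norm w \<le> norm (T *v w)"
    and c: "norm (Z ** T - Y) \<le> c * (spectral_norm Z * spectral_norm T)" "0 \<le> c"
    and \<eta>: "c * (l * p) * spectral_norm T \<le> \<eta> * \<tau>"
    and b: "\<And>w. norm ((L ** Y) *v w) \<le> b * norm (T *v w)"
  shows "L ** Z = L ** Y ** J + D"
    and "norm D \<le> \<eta> * spectral_norm (L ** Z)"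
    and "spectral_norm (L ** Y ** J) \<le> b"
    and "(1 - \<eta>) * spectral_norm (L ** Z) \<le> b"
    and "(\<And>w. a * norm (T *v w) \<le> norm ((L ** Y) *v w))
      \<Longrightarrow> (a - \<eta> * spectral_norm (L ** Z)) * norm v \<le> norm ((L ** Z) *v v)"
proof -
  have TJ: "T ** J = mat 1" unfolding J_def by (rule matrix_inv_mult[OF T])
  have TJv: "T *v (J *v v) = v" for v by (simp add: matrix_vector_mul_assoc TJ)
  show LZ: "L ** Z = L ** Y ** J + D"
    unfolding D_def by (simp add: matrix_diff_ldistrib matrix_diff_rdistrib)
      (simp add: matrix_mul_assoc[symmetric] TJ)
  have J: "spectral_norm J \<le> 1 / \<tau>"
    unfolding J_def by (rule spectral_norm_matrix_inv_le[OF T \<tau>])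
  have "spectral_norm Z \<le> p * spectral_norm (L ** Z)" by (rule spectral_norm_le_mult_left[OF p])
  then have F: "norm (Z ** T - Y) \<le> c * ((p * spectral_norm (L ** Z)) * spectral_norm T)"
    using c by (meson mult_left_mono mult_right_mono order_trans spectral_norm_nonneg)
  have "0 \<le> l" using l spectral_norm_nonneg order_trans by blast
  have "norm D \<le> norm (L ** (Z ** T - Y)) * spectral_norm J"
    unfolding D_def by (rule norm_mult_le_right)
  also have "\<dots> \<le> (l * norm (Z ** T - Y)) * (1 / \<tau>)"
    using J l \<open>0 \<le> l\<close> by (intro mult_mono order_trans[OF norm_mult_le_left] mult_right_mono) auto
  also have "\<dots> \<le> (l * (c * ((p * spectral_norm (L ** Z)) * spectral_norm T))) * (1 / \<tau>)"
    using F \<open>0 \<le> l\<close> \<tau>(1) by (intro mult_right_mono mult_left_mono) auto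
  also have "\<dots> = (c * (l * p) * spectral_norm T) * (spectral_norm (L ** Z) / \<tau>)" by simp
  also have "\<dots> \<le> (\<eta> * \<tau>) * (spectral_norm (L ** Z) / \<tau>)"
    using \<eta> \<tau>(1) by (intro mult_right_mono) auto
  finally show D: "norm D \<le> \<eta> * spectral_norm (L ** Z)" using \<tau>(1) by simp
  show V: "spectral_norm (L ** Y ** J) \<le> b"
    by (rule spectral_norm_le)
      (use b[of "J *v _"] in \<open>simp add: TJv matrix_vector_mul_assoc[symmetric]\<close>)
  show "(1 - \<eta>) * spectral_norm (L ** Z) \<le> b"
    using spectral_norm_add_le[of "L ** Y ** J" D, folded LZ] spectral_norm_le_norm[of D] V D
    by (simp add: algebra_simps)
  assume a: "\<And>w. a * norm (T *v w) \<le> norm ((L ** Y) *v w)"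
  have "a * norm v \<le> norm ((L ** Y ** J) *v v)"
    using a[of "J *v v"] by (simp add: TJv matrix_vector_mul_assoc[symmetric])
  moreover have "norm (D *v v) \<le> \<eta> * spectral_norm (L ** Z) * norm v"
    using norm_matrix_vector_le[of D v] spectral_norm_le_norm[of D] D
    by (meson mult_right_mono norm_ge_zero order_trans)
  moreover have "norm ((L ** Y ** J) *v v) \<le> norm ((L ** Z) *v v) + norm (D *v v)"
    using norm_triangle_ineq4[of "(L ** Z) *v v" "D *v v"]
    by (simp add: LZ matrix_vector_mult_add_rdistrib)
  ultimately show "(a - \<eta> * spectral_norm (L ** Z)) * norm v \<le> norm ((L ** Z) *v v)"
    by (simp add: algebra_simps)
qed

text \<open>
  \<open>V\<^sup>T V - I = T\<^sup>-\<^sup>T (A\<^sup>T A - T\<^sup>T T) T\<^sup>-\<^sup>1\<close>.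
\<close>

lemma cholesky_quotient_orthogonality:
  fixes A :: "real^'n^'m" and T :: "real^'n^'n"
  assumes T: "invertible T" and \<tau>: "0 < \<tau>" "\<And>w. \<tau> * norm w \<le> norm (T *v w)"
    and V: "V = A ** matrix_inv T"
  shows "norm (transpose V ** V - mat 1) \<le> norm (transpose T ** T - transpose A ** A) / \<tau>\<^sup>2"
proof -
  let ?J = "matrix_inv T"
  have TJ: "T ** ?J = mat 1" by (rule matrix_inv_mult[OF T])
  have J: "spectral_norm ?J \<le> 1 / \<tau>" by (rule spectral_norm_matrix_inv_le[OF T \<tau>])
  let ?E = "transpose A ** A - transpose T ** T"
  have "transpose ?J ** (transpose T ** T) ** ?J = transpose (T ** ?J) ** (T ** ?J)"
    by (simp add: matrix_transpose_mul matrix_mul_assoc)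
  then have "transpose V ** V - mat 1 = transpose ?J ** ?E ** ?J"
    unfolding V TJ
    by (simp add: matrix_transpose_mul matrix_mul_assoc matrix_diff_ldistrib matrix_diff_rdistrib)
  moreover have "norm (transpose ?J ** ?E ** ?J) \<le> (1 / \<tau> * norm ?E) * (1 / \<tau>)"
    using J \<tau>(1) by (intro order_trans[OF norm_mult_le_right] mult_mono
        order_trans[OF norm_mult_le_left] mult_right_mono) auto
  ultimately show ?thesis
    by (simp add: power2_eq_square norm_minus_commute)
qed

lemma gram_add_minus_identity_norm_le:
  fixes V D :: "real^'n^'m"
  shows "norm (transpose (V + D) ** (V + D) - mat 1)
    \<le> norm (transpose V ** V - mat 1) + (spectral_norm V + spectral_norm (V + D)) * norm D"
proof -
  have "transpose (V + D) ** (V + D) - mat 1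
      = (transpose V ** V - mat 1) + (transpose V ** D + transpose D ** (V + D))"
    by (simp add: transpose_def matrix_add_ldistrib vec_eq_iff matrix_matrix_mult_def
        distrib_left distrib_right sum.distrib)
  moreover have "norm (transpose V ** D) \<le> spectral_norm V * norm D"
    using norm_mult_le_left[of "transpose V" D] by simp
  moreover have "norm (transpose D ** (V + D)) \<le> norm D * spectral_norm (V + D)"
    using norm_mult_le_right[of "transpose D" "V + D"] by (simp add: norm_transpose)
  moreover have "norm (transpose V ** D + transpose D ** (V + D))
      \<le> norm (transpose V ** D) + norm (transpose D ** (V + D))" by (rule norm_triangle_ineq)
  ultimately show ?thesis
    using norm_triangle_ineq[of "transpose V ** V - mat 1" "transpose V ** D + transpose D ** (V + D)"]
    by (simp add: algebra_simps)
qed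

text \<open>
  Used to take square roots of comparisons between quadratic forms while rounding the constants to rational
  numbers.
\<close>

lemma norm_scaled_le:
  assumes "a * (norm v)\<^sup>2 \<le> b * (norm w)\<^sup>2" "c\<^sup>2 * b \<le> d\<^sup>2 * a" "0 < b" "0 \<le> d"
  shows "c * norm v \<le> d * norm w"
proof (rule power2_le_imp_le)
  have "(c\<^sup>2 * b) * (norm v)\<^sup>2 \<le> (d\<^sup>2 * a) * (norm v)\<^sup>2"
    using assms(2) by (rule mult_right_mono) simp
  also have "\<dots> = d\<^sup>2 * (a * (norm v)\<^sup>2)" by simp
  also have "\<dots> \<le> d\<^sup>2 * (b * (norm w)\<^sup>2)" using assms(1) by (intro mult_left_mono) auto
  finally have "b * (c * norm v)\<^sup>2 \<le> b * (d * norm w)\<^sup>2" by (simp add: power_mult_distrib mult_ac)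
  then show "(c * norm v)\<^sup>2 \<le> (d * norm w)\<^sup>2" using assms(3) by simp
  show "0 \<le> d * norm w" using assms(4) by simp
qed

section \<open>Composition of the backward errors\<close>

text \<open>
  Telescoping: \<open>Z\<^sub>3 R\<^sub>3 - X\<close> is the sum of the residuals \<open>Z\<^sub>1 T\<^sub>1 - X\<close>, \<open>Z\<^sub>2 T\<^sub>2 - Z\<^sub>1\<close>, \<open>Z\<^sub>3 T\<^sub>3 - Z\<^sub>2\<close> of the
  solves and of the errors in \<open>R\<^sub>2\<close> and \<open>R\<^sub>3\<close>, each multiplied by the factors to its right or left.
\<close>

lemma three_step_backward_error:
  fixes X Z1 Z2 Z3 :: "real^'n^'m" and T1 T2 T3 R2 R3 :: "real^'n^'n"
  assumes F1: "norm (Z1 ** T1 - X) \<le> c * (spectral_norm Z1 * spectral_norm T1)"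
    and F2: "norm (Z2 ** T2 - Z1) \<le> c * (spectral_norm Z2 * spectral_norm T2)"
    and F3: "norm (Z3 ** T3 - Z2) \<le> c * (spectral_norm Z3 * spectral_norm T3)"
    and D2: "norm (R2 - T2 ** T1) \<le> c * (spectral_norm T2 * spectral_norm T1)"
    and D3: "norm (R3 - T3 ** R2) \<le> c * (spectral_norm T3 * spectral_norm R2)"
    and z: "spectral_norm Z1 \<le> \<zeta>" "spectral_norm Z2 \<le> \<zeta>" "spectral_norm Z3 \<le> \<zeta>"
    and t: "spectral_norm T1 \<le> t" "spectral_norm T2 \<le> \<rho>" "spectral_norm T3 \<le> \<rho>"
    and c: "0 \<le> c"
  shows "norm (Z3 ** R3 - X) \<le> c * (\<zeta> * t) * (1 + \<rho> + (3 + c) * \<rho>\<^sup>2)"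
proof -
  have pos: "0 \<le> \<zeta>" "0 \<le> t" "0 \<le> \<rho>"
    using z(1) t(1,2) spectral_norm_nonneg order_trans by blast+
  have split: "Z3 ** R3 - X = (Z1 ** T1 - X) + (Z2 ** T2 - Z1) ** T1 + (Z3 ** T3 - Z2) ** (T2 ** T1)
      + Z3 ** (T3 ** (R2 - T2 ** T1)) + Z3 ** (R3 - T3 ** R2)"
    by (simp add: matrix_diff_ldistrib matrix_diff_rdistrib matrix_mul_assoc)
  have b1: "norm (Z1 ** T1 - X) \<le> c * (\<zeta> * t)"
    using F1 by (rule order_trans) (intro mult_mono z t c pos spectral_norm_nonneg order_refl mult_nonneg_nonneg)
  have T21: "spectral_norm (T2 ** T1) \<le> \<rho> * t"
    by (rule order_trans[OF spectral_norm_mult_le]) (intro mult_mono t pos spectral_norm_nonneg)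
  have f2: "norm (Z2 ** T2 - Z1) \<le> c * (\<zeta> * \<rho>)"
    using F2 by (rule order_trans) (intro mult_mono z t c pos spectral_norm_nonneg order_refl mult_nonneg_nonneg)
  have f3: "norm (Z3 ** T3 - Z2) \<le> c * (\<zeta> * \<rho>)"
    using F3 by (rule order_trans) (intro mult_mono z t c pos spectral_norm_nonneg order_refl mult_nonneg_nonneg)
  have d2: "norm (R2 - T2 ** T1) \<le> c * (\<rho> * t)"
    using D2 by (rule order_trans) (intro mult_mono z t c pos spectral_norm_nonneg order_refl mult_nonneg_nonneg)
  have "spectral_norm R2 \<le> spectral_norm (T2 ** T1) + norm (R2 - T2 ** T1)"
    using spectral_norm_add_le[of "T2 ** T1" "R2 - T2 ** T1"] spectral_norm_le_norm[of "R2 - T2 ** T1"]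
    by simp
  then have R2: "spectral_norm R2 \<le> (1 + c) * (\<rho> * t)" using T21 d2 by (simp add: algebra_simps)
  have d3: "norm (R3 - T3 ** R2) \<le> c * (\<rho> * ((1 + c) * (\<rho> * t)))"
    using D3 by (rule order_trans) (intro mult_mono R2 t c pos spectral_norm_nonneg order_refl mult_nonneg_nonneg)
  have b2: "norm ((Z2 ** T2 - Z1) ** T1) \<le> (c * (\<zeta> * \<rho>)) * t"
    by (rule order_trans[OF norm_mult_le_right])
      (intro mult_mono f2 t c pos spectral_norm_nonneg mult_nonneg_nonneg)
  have b3: "norm ((Z3 ** T3 - Z2) ** (T2 ** T1)) \<le> (c * (\<zeta> * \<rho>)) * (\<rho> * t)"
    by (rule order_trans[OF norm_mult_le_right])
      (intro mult_mono f3 T21 c pos spectral_norm_nonneg mult_nonneg_nonneg)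
  have b4: "norm (Z3 ** (T3 ** (R2 - T2 ** T1))) \<le> \<zeta> * (\<rho> * (c * (\<rho> * t)))"
    by (rule order_trans[OF norm_mult_le_left],
        intro mult_mono z pos norm_ge_zero, rule order_trans[OF norm_mult_le_left])
      (intro mult_mono t d2 pos norm_ge_zero)
  have b5: "norm (Z3 ** (R3 - T3 ** R2)) \<le> \<zeta> * (c * (\<rho> * ((1 + c) * (\<rho> * t))))"
    by (rule order_trans[OF norm_mult_le_left]) (intro mult_mono z d3 pos norm_ge_zero)
  have "norm (Z3 ** R3 - X) \<le> norm (Z1 ** T1 - X) + norm ((Z2 ** T2 - Z1) ** T1)
      + norm ((Z3 ** T3 - Z2) ** (T2 ** T1)) + norm (Z3 ** (T3 ** (R2 - T2 ** T1)))
      + norm (Z3 ** (R3 - T3 ** R2))"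
    unfolding split by (intro norm_triangle_le add_right_mono order_refl)
  also have "\<dots> \<le> c * (\<zeta> * t) + (c * (\<zeta> * \<rho>)) * t + (c * (\<zeta> * \<rho>)) * (\<rho> * t)
      + \<zeta> * (\<rho> * (c * (\<rho> * t))) + \<zeta> * (c * (\<rho> * ((1 + c) * (\<rho> * t))))"
    by (intro add_mono b1 b2 b3 b4 b5)
  also have "\<dots> = c * (\<zeta> * t) * (1 + \<rho> + (3 + c) * \<rho>\<^sup>2)"
    by (simp add: power2_eq_square algebra_simps)
  finally show ?thesis .
qed

section \<open>Constants of the rounding error analysis\<close>

text \<open>
  The matrix \<open>X\<close> ties the index type of the columns, on which the smallness assumption on \<open>u\<close> depends, to the
  parameters. \<open>L\<close> is one fixed factor of \<open>B\<close>; all bounds of a step are stated for \<open>L Y\<close> instead of \<open>Y\<close>.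
\<close>

locale cholesky_qr_rounding =
  fixes u :: real and B L :: "real^'m^'m" and X :: "real^'n::{finite,linorder}^'m"
  assumes u_pos: "0 < u" and tall: "CARD('n) \<le> CARD('m)"
    and B_eq: "B = transpose L ** L" and L_inv: "invertible L"
    and u_small: "80 * cond2 B * (real CARD('m) * sqrt (real CARD('m) * real CARD('n)) * u
        + real CARD('n) * (real CARD('n) + 1) * u) \<le> 1"
begin

text \<open>
  The three error units of the analysis: for Gram matrices, Cholesky factorizations, and solves or products of
  triangular factors.
\<close>

definition gram_unit :: real where
  "gram_unit = real CARD('m) * sqrt (real CARD('m) * real CARD('n)) * u"

definition chol_unit :: real where
  "chol_unit = real CARD('n) * (real CARD('n) + 1) * u"

definition solve_unit :: real where
  "solve_unit = (real CARD('n))\<^sup>2 * u"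

text \<open>
  This is the condition number of \<open>L\<close>.
\<close>

definition root_cond :: real where
  "root_cond = sqrt (cond2 B)"

text \<open>
  The spectral norms of \<open>L\<close> (\<open>factor_norm\<close>) and of its inverse (\<open>inv_factor_norm\<close>), expressed through \<open>B\<close>.
\<close>

definition factor_norm :: real where
  "factor_norm = sqrt (spectral_norm B)"

definition inv_factor_norm :: real where
  "inv_factor_norm = sqrt (spectral_norm (matrix_inv B))"

text \<open>
  Up to a constant, \<open>rho\<^sup>2\<close> bounds the error \<open>E\<close> of a computed Gram matrix and its factorization when \<open>L Y\<close> has norm
  about \<open>1\<close>; so it is the size down to which eigenvalues of the Gram matrix can be resolved.
\<close>

definition rho :: real where
  "rho = sqrt (2 * gram_unit + chol_unit) * root_cond"

lemma B_sym: "transpose B = B"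
  by (simp add: B_eq matrix_transpose_mul)

lemma gram_eq: "transpose Y ** B ** Y = transpose (L ** Y) ** (L ** Y)" for Y :: "real^'k^'m"
  by (simp add: B_eq matrix_transpose_mul matrix_mul_assoc)

lemma factor_norm_ge: "spectral_norm L \<le> factor_norm"
  using spectral_norm_le_sqrt_gram[of L] unfolding factor_norm_def B_eq[symmetric] .

lemma factor_norm_nonneg: "0 \<le> factor_norm" "0 \<le> inv_factor_norm"
  by (simp_all add: factor_norm_def inv_factor_norm_def)

lemma norm_le_inv_factor_norm: "norm v \<le> inv_factor_norm * norm (L *v v)"
  using norm_le_inverse_factor[OF L_inv, of v] unfolding inv_factor_norm_def B_eq[symmetric] .

lemma factor_norm_product: "factor_norm * inv_factor_norm = root_cond"
  by (simp add: factor_norm_def inv_factor_norm_def root_cond_def cond2_def real_sqrt_mult)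

lemma root_cond_ge_1: "1 \<le> root_cond"
proof -
  obtain v :: "real^'m" where v: "norm v = 1" using vector_choose_size[of 1] by auto
  have "norm (L *v v) \<le> factor_norm"
    using norm_matrix_vector_le[of L v] factor_norm_ge v by simp
  then have "inv_factor_norm * norm (L *v v) \<le> inv_factor_norm * factor_norm"
    by (intro mult_left_mono factor_norm_nonneg)
  then show ?thesis using norm_le_inv_factor_norm[of v] v factor_norm_product by (simp add: mult.commute)
qed

lemma root_cond_power2: "root_cond\<^sup>2 = cond2 B"
  unfolding root_cond_def by (simp add: cond2_def)

text \<open>
  The hypothesis \<open>n \<le> m\<close> makes \<open>n\<^sup>2\<close> at most \<open>m sqrt (m n)\<close>; thus the effect of the solves is never larger than that
  of the Gram matrix.
\<close>

lemma units:
  shows "0 < solve_unit" "solve_unit \<le> gram_unit" "solve_unit \<le> chol_unit" "solve_unit < chol_unit"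
proof -
  have n: "1 \<le> real CARD('n)" by (simp add: Suc_leI)
  then show "0 < solve_unit" using u_pos by (simp add: solve_unit_def)
  show "solve_unit < chol_unit" "solve_unit \<le> chol_unit"
    using n u_pos by (simp_all add: solve_unit_def chol_unit_def power2_eq_square)
  have nm: "real CARD('n) \<le> real CARD('m)" using tall by simp
  then have "real CARD('n) * real CARD('n) \<le> real CARD('m) * real CARD('n)"
    by (intro mult_right_mono) auto
  then have "real CARD('n) \<le> sqrt (real CARD('m) * real CARD('n))"
    by (simp add: real_le_rsqrt power2_eq_square)
  then have "real CARD('n) * real CARD('n) \<le> real CARD('m) * sqrt (real CARD('m) * real CARD('n))"
    using nm by (intro mult_mono) auto
  then show "solve_unit \<le> gram_unit"
    using u_pos by (simp add: solve_unit_def gram_unit_def power2_eq_square)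
qed

lemma units_root_cond: "80 * ((gram_unit + chol_unit) * root_cond\<^sup>2) \<le> 1"
  using u_small by (simp add: root_cond_power2 gram_unit_def chol_unit_def algebra_simps)

lemma unit_le_root_cond: "0 \<le> x \<Longrightarrow> x \<le> x * root_cond\<^sup>2"
  using mult_left_mono[of 1 "root_cond\<^sup>2" x] one_le_power[OF root_cond_ge_1, of 2] by simp

lemma units_small: "gram_unit + chol_unit \<le> 1 / 80"
  using units_root_cond unit_le_root_cond[of "gram_unit + chol_unit"] units(1-3) by linarith

lemma unit_bounds: "real CARD('m) * sqrt (real CARD('m) * real CARD('n)) * u \<le> 1 / 80"
   "real CARD('n) * (real CARD('n) + 1) * u \<le> 1 / 80"
  using units_small units unfolding gram_unit_def[symmetric] chol_unit_def[symmetric] by linarith+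

lemma rho_power2: "rho\<^sup>2 = (2 * gram_unit + chol_unit) * root_cond\<^sup>2"
  using units by (simp add: rho_def power_mult_distrib)

lemma rho_pos: "0 < rho"
  using units root_cond_ge_1 by (simp add: rho_def)

lemma rho_bounds: "rho\<^sup>2 \<le> 1 / 40" "solve_unit * root_cond\<^sup>2 \<le> rho\<^sup>2 / 3"
  "solve_unit * root_cond\<^sup>2 \<le> 1 / 160"
proof -
  have c: "0 \<le> chol_unit * root_cond\<^sup>2" using units by simp
  have s: "solve_unit * root_cond\<^sup>2 \<le> gram_unit * root_cond\<^sup>2" "solve_unit * root_cond\<^sup>2 \<le> chol_unit * root_cond\<^sup>2"
    using units by (simp_all add: mult_right_mono)
  have k: "80 * (gram_unit * root_cond\<^sup>2) + 80 * (chol_unit * root_cond\<^sup>2) \<le> 1"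
    using units_root_cond by (simp add: algebra_simps)
  have r: "rho\<^sup>2 = 2 * (gram_unit * root_cond\<^sup>2) + chol_unit * root_cond\<^sup>2"
    by (simp add: rho_power2 algebra_simps)
  show "rho\<^sup>2 \<le> 1 / 40" "solve_unit * root_cond\<^sup>2 \<le> rho\<^sup>2 / 3" "solve_unit * root_cond\<^sup>2 \<le> 1 / 160"
    using c s k r by linarith+
qed

section \<open>The computed Cholesky factor of a shifted Gram matrix\<close>

text \<open>
  Everything that follows uses the computed Gram matrix only through its quadratic form, compared with
  \<open>\<parallel>L Y w\<parallel>\<^sup>2 + s \<parallel>w\<parallel>\<^sup>2\<close>. The number \<open>y\<close> is an upper bound for the scale of the error, which is \<open>\<parallel>Y\<parallel>\<^sup>2 \<parallel>B\<parallel>\<close> and not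
  \<open>\<parallel>L Y\<parallel>\<^sup>2\<close>.
\<close>

lemma gram_shift_form_error:
  fixes Y :: "real^'n::{finite,linorder}^'m"
  assumes G: "fl_gram u B Y G" and y: "(spectral_norm Y)\<^sup>2 * spectral_norm B \<le> y"
  shows "spectral_norm (G - transpose Y ** B ** Y) \<le> 22 / 10 * gram_unit * y"
    and "\<bar>w \<bullet> ((G + mat s) *v w) - (norm ((L ** Y) *v w))\<^sup>2 - s * (norm w)\<^sup>2\<bar>
      \<le> 22 / 10 * gram_unit * y * (norm w)\<^sup>2"
proof -
  let ?E = "G - transpose Y ** B ** Y"
  show E: "spectral_norm ?E \<le> 22 / 10 * gram_unit * y"
    using order_trans[OF fl_gram_spectral_error[OF G] mult_left_mono[OF y]] units
    by (simp add: gram_unit_def[symmetric])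
  have "(G + mat s) *v w = ?E *v w + (transpose (L ** Y) ** (L ** Y)) *v w + s *\<^sub>R w"
    unfolding gram_eq[symmetric] 
    by (simp only: matrix_vector_mult_add_rdistrib matrix_vector_mult_diff_rdistrib mat_mult_vec) simp
  then have "w \<bullet> ((G + mat s) *v w) - (norm ((L ** Y) *v w))\<^sup>2 - s * (norm w)\<^sup>2 = w \<bullet> (?E *v w)"
    by (simp add: inner_add_right inner_gram power2_norm_eq_inner)
  moreover have "\<bar>w \<bullet> (?E *v w)\<bar> \<le> 22 / 10 * gram_unit * y * (norm w)\<^sup>2"
    by (rule order_trans[OF abs_inner_matrix_le]) (rule mult_right_mono[OF E zero_le_power2])
  ultimately show "\<bar>w \<bullet> ((G + mat s) *v w) - (norm ((L ** Y) *v w))\<^sup>2 - s * (norm w)\<^sup>2\<bar>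
      \<le> 22 / 10 * gram_unit * y * (norm w)\<^sup>2" by simp
qed

lemma gram_shift_spectral_norm_le:
  fixes Y :: "real^'n::{finite,linorder}^'m"
  assumes G: "fl_gram u B Y G" and y: "(spectral_norm Y)\<^sup>2 * spectral_norm B \<le> y"
    and \<omega>: "spectral_norm (transpose Y ** B ** Y) \<le> \<omega>" and s: "0 \<le> s"
    and h: "\<omega> + s + 22 / 10 * gram_unit * y \<le> h"
  shows "spectral_norm (G + mat s) \<le> h"
proof -
  have "G + mat s = transpose Y ** B ** Y + mat s + (G - transpose Y ** B ** Y)" by simp
  then have "spectral_norm (G + mat s)
      \<le> spectral_norm (transpose Y ** B ** Y) + spectral_norm (mat s :: real^'n::{finite,linorder}^'n::{finite,linorder})
        + spectral_norm (G - transpose Y ** B ** Y)"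
    using spectral_norm_add_le[of "transpose Y ** B ** Y + mat s" "G - transpose Y ** B ** Y"]
      spectral_norm_add_le[of "transpose Y ** B ** Y" "mat s"] by (simp only:)
  then show ?thesis
    using \<omega> h s spectral_norm_mat[of s, where 'n = 'n] gram_shift_form_error(1)[OF G y] by simp
qed

lemma gram_shift_no_breakdown:
  fixes Y :: "real^'n::{finite,linorder}^'m"
  assumes G: "fl_gram u B Y G" and y: "(spectral_norm Y)\<^sup>2 * spectral_norm B \<le> y"
    and h: "spectral_norm (G + mat s) \<le> h"
    and \<alpha>: "\<And>w. \<alpha> * (norm w)\<^sup>2 \<le> (norm ((L ** Y) *v w))\<^sup>2"
    and c: "0 < \<alpha> + s - 22 / 10 * gram_unit * y"
      "105 / 100 * chol_unit * h \<le> \<alpha> + s - 22 / 10 * gram_unit * y"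
  shows "\<not> fl_chol u (G + mat s) None"
proof (rule fl_chol_no_breakdown)
  have "transpose (G + mat s) = transpose G + transpose (mat s)"
    by (simp add: vec_eq_iff transpose_def)
  then show "transpose (G + mat s) = G + mat s" using G unfolding fl_gram_def by simp
  show "spectral_norm (G + mat s) \<le> h" by (rule h)
  show "(\<alpha> + s - 22 / 10 * gram_unit * y) * (norm w)\<^sup>2 \<le> w \<bullet> ((G + mat s) *v w)" for w
    using gram_shift_form_error(2)[OF G y, of w s] \<alpha>[of w]
    unfolding left_diff_distrib distrib_right by linarith
  show "0 < \<alpha> + s - 22 / 10 * gram_unit * y" by (rule c)
  show "105 / 100 * (real CARD('n) * (real CARD('n) + 1) * u) * h \<le> \<alpha> + s - 22 / 10 * gram_unit * y"
    using c(2) by (simp add: chol_unit_def)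
qed (rule u_pos unit_bounds)+

text \<open>
  Since \<open>w \<bullet> (T\<^sup>T T) w = \<parallel>T w\<parallel>\<^sup>2\<close>, the errors of the Gram matrix and of the factorization simply add up.
\<close>

lemma gram_shift_factor:
  fixes Y :: "real^'n::{finite,linorder}^'m"
  assumes G: "fl_gram u B Y G" and y: "(spectral_norm Y)\<^sup>2 * spectral_norm B \<le> y"
    and h: "spectral_norm (G + mat s) \<le> h"
    and T: "fl_chol u (G + mat s) (Some T)"
  shows "(spectral_norm T)\<^sup>2 \<le> 103 / 100 * h"
    and "\<bar>(norm (T *v w))\<^sup>2 - (norm ((L ** Y) *v w))\<^sup>2 - s * (norm w)\<^sup>2\<bar>
      \<le> (22 / 10 * gram_unit * y + 106 / 100 * chol_unit * h) * (norm w)\<^sup>2"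
    and "s = 0 \<Longrightarrow> norm (transpose T ** T - transpose (L ** Y) ** (L ** Y))
      \<le> 295 / 100 * gram_unit * y + 106 / 100 * chol_unit * h"
proof -
  have TE: "\<bar>transpose T ** T - (G + mat s)\<bar> \<le> gamma_fl u (CARD('n) + 1) *\<^sub>R (transpose \<bar>T\<bar> ** \<bar>T\<bar>)"
    using T by (auto elim: fl_chol.cases)
  note chol = fl_chol_success_bounds[OF TE h u_pos unit_bounds(2)]
  show "(spectral_norm T)\<^sup>2 \<le> 103 / 100 * h" by (rule chol)
  let ?E = "transpose T ** T - (G + mat s)"
  have E: "norm ?E \<le> 106 / 100 * chol_unit * h" using chol(2) by (simp add: chol_unit_def)
  have "\<bar>w \<bullet> (?E *v w)\<bar> \<le> 106 / 100 * chol_unit * h * (norm w)\<^sup>2"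
    by (rule order_trans[OF abs_inner_matrix_le])
      (intro mult_right_mono order_trans[OF spectral_norm_le_norm E] zero_le_power2)
  moreover have "w \<bullet> (?E *v w) = (norm (T *v w))\<^sup>2 - w \<bullet> ((G + mat s) *v w)"
    unfolding matrix_vector_mult_diff_rdistrib inner_diff_right inner_gram ..
  ultimately show "\<bar>(norm (T *v w))\<^sup>2 - (norm ((L ** Y) *v w))\<^sup>2 - s * (norm w)\<^sup>2\<bar>
      \<le> (22 / 10 * gram_unit * y + 106 / 100 * chol_unit * h) * (norm w)\<^sup>2"
    using gram_shift_form_error(2)[OF G y, of w s] unfolding distrib_right by linarith
  assume "s = 0"
  then have "G + mat s = G" by (simp add: vec_eq_iff mat_def)
  then have "transpose T ** T - transpose (L ** Y) ** (L ** Y) = ?E + (G - transpose Y ** B ** Y)"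
    by (simp add: gram_eq)
  moreover have "norm (G - transpose Y ** B ** Y) \<le> 295 / 100 * gram_unit * y"
    using order_trans[OF fl_gram_norm_error[OF G B_sym tall u_pos unit_bounds(1)] mult_left_mono[OF y]]
      units by (simp add: gram_unit_def[symmetric])
  ultimately show "norm (transpose T ** T - transpose (L ** Y) ** (L ** Y))
      \<le> 295 / 100 * gram_unit * y + 106 / 100 * chol_unit * h"
    using E norm_triangle_ineq[of ?E "G - transpose Y ** B ** Y"] by (simp only:)
qed

lemma solve_residual:
  fixes Y :: "real^'n::{finite,linorder}^'m"
  assumes "fl_solve u Y T Z"
  shows "norm (Z ** T - Y) \<le> 102 / 100 * solve_unit * (spectral_norm Z * spectral_norm T)"
  using fl_solve_residual[OF assms u_pos unit_bounds(2)] by (simp add: solve_unit_def)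

lemma spectral_norm_le_inv_factor_norm: "spectral_norm Z \<le> inv_factor_norm * spectral_norm (L ** Z)"
  for Z :: "real^'n::{finite,linorder}^'m"
  by (rule spectral_norm_le_mult_left[OF norm_le_inv_factor_norm factor_norm_nonneg(2)])

text \<open>
  The scale of the Gram error may exceed \<open>\<parallel>L Z\<parallel>\<^sup>2\<close> by up to the condition number of \<open>B\<close>.
\<close>

lemma norm_power2_le_gram:
  fixes Z :: "real^'n::{finite,linorder}^'m"
  assumes "(spectral_norm (L ** Z))\<^sup>2 \<le> \<omega>"
  shows "(spectral_norm Z)\<^sup>2 * spectral_norm B \<le> root_cond\<^sup>2 * \<omega>"
proof -
  have "spectral_norm Z * factor_norm \<le> (inv_factor_norm * spectral_norm (L ** Z)) * factor_norm"
    by (intro mult_right_mono spectral_norm_le_inv_factor_norm factor_norm_nonneg)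
  also have "\<dots> = root_cond * spectral_norm (L ** Z)" by (simp add: factor_norm_product[symmetric])
  finally have "(spectral_norm Z * factor_norm)\<^sup>2 \<le> (root_cond * spectral_norm (L ** Z))\<^sup>2"
    using factor_norm_nonneg by (intro power_mono mult_nonneg_nonneg) auto
  also have "\<dots> \<le> root_cond\<^sup>2 * \<omega>" using assms by (simp add: power_mult_distrib mult_left_mono)
  finally show ?thesis by (simp add: power_mult_distrib factor_norm_def)
qed

lemma gram_norm_le: "spectral_norm (transpose Y ** B ** Y) \<le> (spectral_norm (L ** Y))\<^sup>2"
  for Y :: "real^'n::{finite,linorder}^'m"
  unfolding gram_eq using spectral_norm_mult_le[of "transpose (L ** Y)" "L ** Y"]
  by (simp add: power2_eq_square)

section \<open>The three steps\<close>

text \<open>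
  What the second and the third step have in common: all eigenvalues of \<open>(L Y)\<^sup>T (L Y)\<close> are at least thirty times
  as large as the total error of the Gram matrix and its factorization.
\<close>

lemma unshifted_step:
  fixes Y :: "real^'n::{finite,linorder}^'m"
  assumes G: "fl_gram u B Y G"
    and \<omega>: "(spectral_norm (L ** Y))\<^sup>2 \<le> 106 / 100"
    and \<alpha>: "\<And>w. 36 * rho\<^sup>2 * (norm w)\<^sup>2 \<le> (norm ((L ** Y) *v w))\<^sup>2"
  shows "\<not> fl_chol u (G + mat 0) None"
    and "fl_chol u (G + mat 0) (Some T) \<Longrightarrow> (spectral_norm T)\<^sup>2 \<le> 113 / 100"
    and "fl_chol u (G + mat 0) (Some T) \<Longrightarrow>
      \<bar>(norm (T *v w))\<^sup>2 - (norm ((L ** Y) *v w))\<^sup>2\<bar> \<le> 117 / 100 * rho\<^sup>2 * (norm w)\<^sup>2"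
    and "fl_chol u (G + mat 0) (Some T) \<Longrightarrow>
      norm (transpose T ** T - transpose (L ** Y) ** (L ** Y))
        \<le> 313 / 100 * (gram_unit * root_cond\<^sup>2) + 116 / 100 * (chol_unit * root_cond\<^sup>2)"
proof -
  define y where "y = root_cond\<^sup>2 * (106 / 100)"
  have y: "(spectral_norm Y)\<^sup>2 * spectral_norm B \<le> y" unfolding y_def by (rule norm_power2_le_gram[OF \<omega>])
  have gy: "gram_unit * y = 106 / 100 * (gram_unit * root_cond\<^sup>2)" by (simp add: y_def)
  have gk: "0 < gram_unit * root_cond\<^sup>2" "0 < chol_unit * root_cond\<^sup>2" using units root_cond_ge_1 by simp_all
  have ck: "chol_unit \<le> chol_unit * root_cond\<^sup>2" using units by (intro unit_le_root_cond) auto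
  have k80: "80 * (gram_unit * root_cond\<^sup>2) + 80 * (chol_unit * root_cond\<^sup>2) \<le> 1"
    using units_root_cond by (simp add: algebra_simps)
  have r: "rho\<^sup>2 = 2 * (gram_unit * root_cond\<^sup>2) + chol_unit * root_cond\<^sup>2"
    by (simp add: rho_power2 algebra_simps)
  have h: "spectral_norm (G + mat 0) \<le> 109 / 100"
  proof (rule gram_shift_spectral_norm_le[OF G y])
    show "spectral_norm (transpose Y ** B ** Y) \<le> 106 / 100"
      using gram_norm_le[of Y] \<omega> by simp
    show "106 / 100 + 0 + 22 / 10 * gram_unit * y \<le> 109 / 100"
      using gy k80 gk by linarith
  qed simp
  have c: "105 / 100 * chol_unit * (109 / 100) < 36 * rho\<^sup>2 + 0 - 22 / 10 * gram_unit * y"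
    using gy r gk ck by linarith
  show "\<not> fl_chol u (G + mat 0) None"
  proof (rule gram_shift_no_breakdown[OF G y h \<alpha>])
    have "0 < 105 / 100 * chol_unit * (109 / 100)" using units(1,4) by simp
    then show "0 < 36 * rho\<^sup>2 + 0 - 22 / 10 * gram_unit * y" using c by linarith
  qed (use c in linarith)
  assume T: "fl_chol u (G + mat 0) (Some T)"
  note F = gram_shift_factor[OF G y h T]
  show "(spectral_norm T)\<^sup>2 \<le> 113 / 100" using F(1) by simp
  have "22 / 10 * gram_unit * y + 106 / 100 * chol_unit * (109 / 100) \<le> 117 / 100 * rho\<^sup>2"
    using gy r gk ck by linarith
  then show "\<bar>(norm (T *v w))\<^sup>2 - (norm ((L ** Y) *v w))\<^sup>2\<bar> \<le> 117 / 100 * rho\<^sup>2 * (norm w)\<^sup>2"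
    using order_trans[OF F(2)[of w] mult_right_mono[OF _ zero_le_power2]]
    by (simp only: mult_zero_left diff_zero)
  show "norm (transpose T ** T - transpose (L ** Y) ** (L ** Y))
        \<le> 313 / 100 * (gram_unit * root_cond\<^sup>2) + 116 / 100 * (chol_unit * root_cond\<^sup>2)"
    using F(3)[OF refl] gy ck gk by linarith
qed

text \<open>
  The total error is at most \<open>0.13 s\<close>, so \<open>\<parallel>T w\<parallel>\<^sup>2\<close> lies between \<open>\<parallel>L X w\<parallel>\<^sup>2 + 0.87 s \<parallel>w\<parallel>\<^sup>2\<close> and
  \<open>\<parallel>L X w\<parallel>\<^sup>2 + 1.13 s \<parallel>w\<parallel>\<^sup>2\<close>. The lower estimate shows that the quotient has norm at most \<open>1\<close> and that
  \<open>\<parallel>T\<^sup>-\<^sup>1\<parallel>\<close> is controlled by the shift alone. The upper estimate and the assumption on \<open>\<parallel>L X w\<parallel>\<close>, where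
  \<open>9216 = 96\<^sup>2\<close>, give \<open>\<parallel>T w\<parallel>\<^sup>2 \<le> (1 + 1.13 / (837 \<rho>\<^sup>2)) \<parallel>L X w\<parallel>\<^sup>2\<close>, so the quotient has singular values at least
  \<open>6.15 \<rho>\<close>; the solves take off at most \<open>0.15 \<rho>\<close>.
\<close>

lemma first_step:
  defines "\<xi> \<equiv> (spectral_norm X)\<^sup>2 * spectral_norm B"
  defines "s \<equiv> 11 * (2 * gram_unit + chol_unit) * \<xi>"
  assumes G: "fl_gram u B X G" and \<xi>: "0 < \<xi>"
    and \<sigma>: "\<And>w. 9216 * (2 * gram_unit + chol_unit) * rho\<^sup>2 * \<xi> * (norm w)\<^sup>2 \<le> (norm ((L ** X) *v w))\<^sup>2"
  shows "\<not> fl_chol u (G + mat s) None"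
    and "fl_chol u (G + mat s) (Some T) \<Longrightarrow> fl_solve u X T Z \<Longrightarrow>
      (spectral_norm T)\<^sup>2 \<le> 135 / 100 * \<xi> \<and> spectral_norm (L ** Z) \<le> 1022 / 1000 \<and>
      (\<forall>v. 6 * rho * norm v \<le> norm ((L ** Z) *v v))"
proof -
  define g where "g = 2 * gram_unit + chol_unit"
  have u: "0 < gram_unit" "0 < chol_unit" "gram_unit + chol_unit \<le> 1 / 80"
    using units units_small by linarith+
  have g: "0 < g" "g \<le> 1 / 40" using u by (auto simp: g_def)
  have s: "s = 11 * (g * \<xi>)" by (simp add: s_def g_def)
  have gx: "0 < gram_unit * \<xi>" "0 < chol_unit * \<xi>" "g * \<xi> = 2 * (gram_unit * \<xi>) + chol_unit * \<xi>"
    "gram_unit * \<xi> + chol_unit * \<xi> \<le> \<xi> / 80"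
    using u \<xi> mult_right_mono[OF u(3), of \<xi>] by (auto simp: g_def algebra_simps)
  have y: "(spectral_norm X)\<^sup>2 * spectral_norm B \<le> \<xi>" by (simp add: \<xi>_def)
  have h: "spectral_norm (G + mat s) \<le> 131 / 100 * \<xi>"
  proof (rule gram_shift_spectral_norm_le[OF G y])
    have "spectral_norm (transpose X ** B ** X) \<le> spectral_norm (transpose X ** B) * spectral_norm X"
      by (rule spectral_norm_mult_le)
    also have "\<dots> \<le> (spectral_norm X * spectral_norm B) * spectral_norm X"
      using spectral_norm_mult_le[of "transpose X" B] by (intro mult_right_mono) auto
    finally show "spectral_norm (transpose X ** B ** X) \<le> \<xi>"
      by (simp add: \<xi>_def power2_eq_square mult_ac)
    show "0 \<le> s" using g \<xi> by (simp add: s)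
    show "\<xi> + s + 22 / 10 * gram_unit * \<xi> \<le> 131 / 100 * \<xi>"
      using gx \<xi> unfolding s by linarith
  qed
  have c: "105 / 100 * chol_unit * (131 / 100 * \<xi>) < 0 + s - 22 / 10 * gram_unit * \<xi>"
    unfolding s using gx by linarith
  show "\<not> fl_chol u (G + mat s) None"
  proof (rule gram_shift_no_breakdown[OF G y h])
    show "0 * (norm w)\<^sup>2 \<le> (norm ((L ** X) *v w))\<^sup>2" for w :: "real^'n::{finite,linorder}" by simp
    have "0 < 105 / 100 * chol_unit * (131 / 100 * \<xi>)" using u \<xi> by simp
    then show "0 < 0 + s - 22 / 10 * gram_unit * \<xi>" using c by linarith
  qed (use c in simp)
  assume T: "fl_chol u (G + mat s) (Some T)" and Z: "fl_solve u X T Z"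
  note F = gram_shift_factor[OF G y h T]
  have T2: "(spectral_norm T)\<^sup>2 \<le> 135 / 100 * \<xi>" using F(1) \<xi> by simp
  have e: "22 / 10 * gram_unit * \<xi> + 106 / 100 * chol_unit * (131 / 100 * \<xi>) \<le> 13 / 100 * s"
    unfolding s using gx by linarith
  have T4: "\<bar>(norm (T *v w))\<^sup>2 - (norm ((L ** X) *v w))\<^sup>2 - s * (norm w)\<^sup>2\<bar> \<le> 13 / 100 * (s * (norm w)\<^sup>2)"
    for w using order_trans[OF F(2)[of w] mult_right_mono[OF e zero_le_power2]] by (simp only: mult.assoc)
  have s0: "0 < s" using g \<xi> by (simp add: s)
  define \<tau> where "\<tau> = sqrt (87 / 100 * s)"
  have \<tau>: "0 < \<tau>" "\<tau>\<^sup>2 = 87 / 100 * s" using s0 by (auto simp: \<tau>_def)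
  have \<tau>_le: "\<tau> * norm w \<le> norm (T *v w)" for w
  proof (rule power2_le_imp_le)
    show "(\<tau> * norm w)\<^sup>2 \<le> (norm (T *v w))\<^sup>2"
      using T4[of w] zero_le_power2[of "norm ((L ** X) *v w)"]
      unfolding power_mult_distrib \<tau>(2) by (simp only: abs_le_iff) argo
  qed simp
  have b: "norm ((L ** X) *v w) \<le> 1 * norm (T *v w)" for w
  proof -
    have "0 \<le> s * (norm w)\<^sup>2" using s0 by simp
    then have "(norm ((L ** X) *v w))\<^sup>2 \<le> (norm (T *v w))\<^sup>2" using T4[of w] by linarith
    then show ?thesis using power2_le_imp_le[of "norm ((L ** X) *v w)" "norm (T *v w)"] by simp
  qed
  have a: "615 / 100 * rho * norm (T *v w) \<le> norm ((L ** X) *v w)" for w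
  proof -
    have "837 * rho\<^sup>2 * (s * (norm w)\<^sup>2) \<le> (norm ((L ** X) *v w))\<^sup>2"
    proof -
      have "837 * rho\<^sup>2 * (s * (norm w)\<^sup>2) = 9207 * (g * rho\<^sup>2 * \<xi> * (norm w)\<^sup>2)" by (simp add: s)
      also have "\<dots> \<le> 9216 * (g * rho\<^sup>2 * \<xi> * (norm w)\<^sup>2)"
        using g \<xi> by (intro mult_right_mono) auto
      also have "\<dots> \<le> (norm ((L ** X) *v w))\<^sup>2" using \<sigma>[of w] unfolding g_def by (simp only: mult.assoc)
      finally show ?thesis .
    qed
    moreover have "(norm (T *v w))\<^sup>2 \<le> (norm ((L ** X) *v w))\<^sup>2 + 113 / 100 * (s * (norm w)\<^sup>2)"
      using T4[of w] by linarith
    then have "837 * rho\<^sup>2 * (norm (T *v w))\<^sup>2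
        \<le> 837 * rho\<^sup>2 * ((norm ((L ** X) *v w))\<^sup>2 + 113 / 100 * (s * (norm w)\<^sup>2))"
      by (rule mult_left_mono) simp
    ultimately have "837 * rho\<^sup>2 * (norm (T *v w))\<^sup>2
        \<le> (837 * rho\<^sup>2 + 113 / 100) * (norm ((L ** X) *v w))\<^sup>2"
      by (simp add: algebra_simps)
    also have "\<dots> \<le> 221 / 10 * (norm ((L ** X) *v w))\<^sup>2"
      using rho_bounds(1) by (intro mult_right_mono) auto
    finally have "837 * rho\<^sup>2 * (norm (T *v w))\<^sup>2 \<le> 221 / 10 * (norm ((L ** X) *v w))\<^sup>2" .
    from norm_scaled_le[OF this, of "615 / 100 * rho" 1] show ?thesis
      by (simp add: power_mult_distrib power2_eq_square[of "123 :: real"] power_divide)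
  qed
  have \<eta>: "102 / 100 * solve_unit * (factor_norm * inv_factor_norm) * spectral_norm T \<le> 13 / 100 * rho * \<tau>"
  proof (rule power2_le_imp_le)
    have "solve_unit\<^sup>2 \<le> (g / 3)\<^sup>2"
      using units by (intro power_mono) (auto simp: g_def)
    then have "solve_unit\<^sup>2 \<le> g\<^sup>2 / 9" by (simp add: power_divide)
    then have "(102 / 100)\<^sup>2 * root_cond\<^sup>2 * (solve_unit\<^sup>2 * (spectral_norm T)\<^sup>2)
        \<le> (102 / 100)\<^sup>2 * root_cond\<^sup>2 * (g\<^sup>2 / 9 * (135 / 100 * \<xi>))"
      using T2 by (intro mult_left_mono mult_mono) auto
    also have "\<dots> = (102 / 100)\<^sup>2 * 135 / 900 * (g\<^sup>2 * root_cond\<^sup>2 * \<xi>)" by simp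
    also have "\<dots> \<le> (13 / 100)\<^sup>2 * 957 / 100 * (g\<^sup>2 * root_cond\<^sup>2 * \<xi>)"
      using \<xi> by (intro mult_right_mono) (auto simp: power2_eq_square)
    also have "\<dots> = (13 / 100)\<^sup>2 * (rho\<^sup>2 * \<tau>\<^sup>2)"
      by (simp add: rho_power2 \<tau>(2) s g_def[symmetric] power2_eq_square[of g])
    finally show "(102 / 100 * solve_unit * (factor_norm * inv_factor_norm) * spectral_norm T)\<^sup>2
        \<le> (13 / 100 * rho * \<tau>)\<^sup>2"
      unfolding factor_norm_product power_mult_distrib by (simp only: mult_ac)
    show "0 \<le> 13 / 100 * rho * \<tau>" using rho_pos \<tau> by simp
  qed
  have su: "0 \<le> 102 / 100 * solve_unit" using units by simp
  note Z = triangular_solve_perturbation[OF fl_chol_factor(2)[OF T] factor_norm_ge norm_le_inv_factor_norm factor_norm_nonneg(2) \<tau>(1) \<tau>_le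
      solve_residual[OF Z] su \<eta> b]
  have rho: "rho \<le> 16 / 100"
    by (rule power2_le_imp_le) (use rho_bounds(1) in \<open>auto simp: power2_eq_square\<close>)
  have "(1 - 13 / 100 * (16 / 100)) * spectral_norm (L ** Z) \<le> (1 - 13 / 100 * rho) * spectral_norm (L ** Z)"
    using rho by (intro mult_right_mono) auto
  then have LZ: "spectral_norm (L ** Z) \<le> 1022 / 1000" using Z(4) by simp
  have "6 * rho * norm v \<le> norm ((L ** Z) *v v)" for v
  proof -
    have "13 / 100 * rho * spectral_norm (L ** Z) \<le> 13 / 100 * rho * (1022 / 1000)"
      using LZ rho_pos by (intro mult_left_mono) auto
    then have "6 * rho \<le> 615 / 100 * rho - 13 / 100 * rho * spectral_norm (L ** Z)"
      using rho_pos by linarith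
    then show ?thesis
      using Z(5)[OF a, of v] by (meson mult_right_mono norm_ge_zero order_trans)
  qed
  with T2 LZ show "(spectral_norm T)\<^sup>2 \<le> 135 / 100 * \<xi> \<and> spectral_norm (L ** Z) \<le> 1022 / 1000 \<and>
      (\<forall>v. 6 * rho * norm v \<le> norm ((L ** Z) *v v))" by blast
qed

text \<open>
  The error is now at most \<open>3.25\<close> percent of the form \<open>\<parallel>L Y w\<parallel>\<^sup>2\<close> itself, whatever the condition number of \<open>L Y\<close>:
  therefore one unshifted step makes \<open>L Z\<close> almost orthonormal. The factor \<open>T\<close> may still be as badly
  conditioned as \<open>1 / \<rho>\<close>, but the error of the solves, of order \<open>n\<^sup>2 u sqrt (cond2 B) / \<rho>\<close>, stays below one percent.
\<close>

lemma second_step: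
  fixes Y :: "real^'n::{finite,linorder}^'m"
  assumes G: "fl_gram u B Y G"
    and \<omega>: "(spectral_norm (L ** Y))\<^sup>2 \<le> 106 / 100"
    and \<alpha>: "\<And>w. 36 * rho\<^sup>2 * (norm w)\<^sup>2 \<le> (norm ((L ** Y) *v w))\<^sup>2"
    and T: "fl_chol u (G + mat 0) (Some T)" and Z: "fl_solve u Y T Z"
  shows "spectral_norm (L ** Z) \<le> 1028 / 1000" "97 / 100 * norm v \<le> norm ((L ** Z) *v v)"
proof -
  note step = unshifted_step(2-4)[OF G \<omega> \<alpha> T]
  have inv: "invertible T" by (rule fl_chol_factor(2)[OF T])
  have e: "\<bar>(norm (T *v w))\<^sup>2 - (norm ((L ** Y) *v w))\<^sup>2\<bar> \<le> 325 / 10000 * (norm ((L ** Y) *v w))\<^sup>2" for w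
    using step(2)[of w] \<alpha>[of w] by linarith
  define \<tau> where "\<tau> = 59 / 10 * rho"
  have \<tau>: "0 < \<tau>" using rho_pos by (simp add: \<tau>_def)
  have \<tau>_le: "\<tau> * norm w \<le> norm (T *v w)" for w
  proof (rule power2_le_imp_le)
    have "(59 / 10)\<^sup>2 * (rho\<^sup>2 * (norm w)\<^sup>2) \<le> 9675 / 10000 * (36 * (rho\<^sup>2 * (norm w)\<^sup>2))"
      by (simp add: power2_eq_square)
    then show "(\<tau> * norm w)\<^sup>2 \<le> (norm (T *v w))\<^sup>2"
      using e[of w] \<alpha>[of w] unfolding \<tau>_def power_mult_distrib by (simp only: mult.assoc)
  qed simp
  have b: "norm ((L ** Y) *v w) \<le> 1017 / 1000 * norm (T *v w)" for w
  proof -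
    have "9675 / 10000 * (norm ((L ** Y) *v w))\<^sup>2 \<le> 1 * (norm (T *v w))\<^sup>2"
      using e[of w] by linarith
    from norm_scaled_le[OF this, of 1 "1017 / 1000"] show ?thesis
      by (simp add: power2_eq_square)
  qed
  have a: "984 / 1000 * norm (T *v w) \<le> norm ((L ** Y) *v w)" for w
  proof -
    have "1 * (norm (T *v w))\<^sup>2 \<le> 10325 / 10000 * (norm ((L ** Y) *v w))\<^sup>2"
      using e[of w] by linarith
    from norm_scaled_le[OF this, of "984 / 1000" 1] show ?thesis
      by (simp add: power2_eq_square)
  qed
  have \<eta>: "102 / 100 * solve_unit * (factor_norm * inv_factor_norm) * spectral_norm T \<le> 1 / 100 * \<tau>"
  proof (rule power2_le_imp_le)
    have "solve_unit * root_cond \<le> solve_unit * root_cond\<^sup>2"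
      using root_cond_ge_1 units by (intro mult_left_mono) (auto simp: power2_eq_square)
    then have "solve_unit * root_cond \<le> rho\<^sup>2 / 3" using rho_bounds(2) by linarith
    \<comment> \<open>As \<open>rho\<close> is below \<open>0.16\<close>; with \<open>10 / 187\<close> the perturbation \<open>\<eta>\<close> just stays below one percent.\<close>
    moreover have "rho\<^sup>2 / 3 \<le> 10 / 187 * rho"
    proof -
      have "rho \<le> 16 / 100"
        by (rule power2_le_imp_le) (use rho_bounds(1) in \<open>auto simp: power2_eq_square\<close>)
      then show ?thesis using rho_pos by (simp add: power2_eq_square)
    qed
    ultimately have "(solve_unit * root_cond)\<^sup>2 \<le> (10 / 187 * rho)\<^sup>2"
      using units root_cond_ge_1 by (intro power_mono) auto
    then have "(102 / 100)\<^sup>2 * ((solve_unit * root_cond)\<^sup>2 * (spectral_norm T)\<^sup>2)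
        \<le> (102 / 100)\<^sup>2 * ((10 / 187 * rho)\<^sup>2 * (113 / 100))"
      using step(1) by (intro mult_left_mono mult_mono) auto
    also have "\<dots> \<le> (1 / 100 * \<tau>)\<^sup>2"
      by (simp add: \<tau>_def power2_eq_square)
    finally show "(102 / 100 * solve_unit * (factor_norm * inv_factor_norm) * spectral_norm T)\<^sup>2 \<le> (1 / 100 * \<tau>)\<^sup>2"
      unfolding factor_norm_product power_mult_distrib by (simp only: mult_ac)
    show "0 \<le> 1 / 100 * \<tau>" using \<tau> by simp
  qed
  have su: "0 \<le> 102 / 100 * solve_unit" using units by simp
  note Z = triangular_solve_perturbation[OF inv factor_norm_ge norm_le_inv_factor_norm factor_norm_nonneg(2) \<tau> \<tau>_le
      solve_residual[OF Z] su \<eta> b]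
  show LZ: "spectral_norm (L ** Z) \<le> 1028 / 1000" using Z(4) by simp
  then have "97 / 100 \<le> 984 / 1000 - 1 / 100 * spectral_norm (L ** Z)" by simp
  then show "97 / 100 * norm v \<le> norm ((L ** Z) *v v)"
    using Z(5)[OF a, of v] by (meson mult_right_mono norm_ge_zero order_trans)
qed

text \<open>
  Now \<open>T\<close> has condition number close to \<open>1\<close>, so \<open>L Z\<close> is the exact quotient up to \<open>1.18 n (n + 1) u cond2 B\<close>, and the
  exact quotient deviates from orthonormality by \<open>E / 0.91\<close> in the Frobenius norm.
\<close>

lemma third_step:
  fixes Y :: "real^'n::{finite,linorder}^'m"
  assumes G: "fl_gram u B Y G"
    and \<omega>: "(spectral_norm (L ** Y))\<^sup>2 \<le> 106 / 100"
    and \<alpha>: "\<And>w. 97 / 100 * norm w \<le> norm ((L ** Y) *v w)"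
    and T: "fl_chol u (G + mat 0) (Some T)" and Z: "fl_solve u Y T Z"
  shows "spectral_norm (L ** Z) \<le> 103 / 100"
    "norm (transpose Z ** B ** Z - mat 1) \<le> 8 * ((gram_unit + chol_unit) * root_cond\<^sup>2)"
proof -
  have \<alpha>2: "94 / 100 * (norm w)\<^sup>2 \<le> (norm ((L ** Y) *v w))\<^sup>2" for w
  proof -
    have "(97 / 100 * norm w)\<^sup>2 \<le> (norm ((L ** Y) *v w))\<^sup>2" by (rule power_mono[OF \<alpha>]) simp
    moreover have "(97 / 100 * norm w)\<^sup>2 = 9409 / 10000 * (norm w)\<^sup>2"
      by (simp add: power2_eq_square)
    ultimately show ?thesis using zero_le_power2[of "norm w"] by linarith
  qed
  have r40: "rho\<^sup>2 * (norm w)\<^sup>2 \<le> 1 / 40 * (norm w)\<^sup>2" for w :: "real^'n::{finite,linorder}"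
    using rho_bounds(1) by (rule mult_right_mono) simp
  have \<alpha>': "36 * rho\<^sup>2 * (norm w)\<^sup>2 \<le> (norm ((L ** Y) *v w))\<^sup>2" for w
    using \<alpha>2[of w] r40[of w] zero_le_power2[of "norm w"] unfolding mult.assoc by linarith
  note step = unshifted_step(2-4)[OF G \<omega> \<alpha>' T]
  have inv: "invertible T" by (rule fl_chol_factor(2)[OF T])
  have e: "\<bar>(norm (T *v w))\<^sup>2 - (norm ((L ** Y) *v w))\<^sup>2\<bar> \<le> 3 / 100 * (norm w)\<^sup>2" for w
    using step(2)[of w] r40[of w] zero_le_power2[of "norm w"] unfolding mult.assoc by linarith
  define \<tau> :: real where "\<tau> = sqrt (91 / 100)"
  have \<tau>: "0 < \<tau>" "\<tau>\<^sup>2 = 91 / 100" by (simp_all add: \<tau>_def)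
  have lo: "91 / 100 * (norm w)\<^sup>2 \<le> (norm (T *v w))\<^sup>2" for w
    using e[of w] \<alpha>2[of w] by linarith
  have \<tau>_le: "\<tau> * norm w \<le> norm (T *v w)" for w
    by (rule power2_le_imp_le) (simp_all only: power_mult_distrib \<tau>(2) lo norm_ge_zero)
  have b: "norm ((L ** Y) *v w) \<le> 1017 / 1000 * norm (T *v w)" for w
  proof -
    have "1 * (norm ((L ** Y) *v w))\<^sup>2 \<le> 1033 / 1000 * (norm (T *v w))\<^sup>2"
      using e[of w] lo[of w] by linarith
    from norm_scaled_le[OF this, of 1 "1017 / 1000"] show ?thesis
      by (simp add: power2_eq_square)
  qed
  have \<eta>: "102 / 100 * solve_unit * (factor_norm * inv_factor_norm) * spectral_norm T
      \<le> 114 / 100 * (solve_unit * root_cond) * \<tau>"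
  proof -
    have "102 / 100 * spectral_norm T \<le> 114 / 100 * \<tau>"
    proof (rule power2_le_imp_le)
      have "(102 / 100 * spectral_norm T)\<^sup>2 = 10404 / 10000 * (spectral_norm T)\<^sup>2"
        "(114 / 100 * \<tau>)\<^sup>2 = 12996 / 10000 * \<tau>\<^sup>2" by (simp_all add: power2_eq_square)
      then show "(102 / 100 * spectral_norm T)\<^sup>2 \<le> (114 / 100 * \<tau>)\<^sup>2"
        using step(1) unfolding \<tau>(2) by linarith
    qed (use \<tau> in simp)
    then have "solve_unit * root_cond * (102 / 100 * spectral_norm T) \<le> solve_unit * root_cond * (114 / 100 * \<tau>)"
      using units root_cond_ge_1 by (intro mult_left_mono) auto
    then show ?thesis unfolding factor_norm_product by (simp only: mult_ac)
  qed
  have su: "0 \<le> 102 / 100 * solve_unit" using units by simp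
  note P = triangular_solve_perturbation[OF inv factor_norm_ge norm_le_inv_factor_norm factor_norm_nonneg(2) \<tau>(1) \<tau>_le
      solve_residual[OF Z] su \<eta> b]
  have sk: "solve_unit * root_cond \<le> solve_unit * root_cond\<^sup>2"
    using root_cond_ge_1 units by (intro mult_left_mono) (auto simp: power2_eq_square)
  have "(1 - 114 / 16000) * spectral_norm (L ** Z)
      \<le> (1 - 114 / 100 * (solve_unit * root_cond)) * spectral_norm (L ** Z)"
  proof (rule mult_right_mono)
    show "1 - 114 / 16000 \<le> 1 - 114 / 100 * (solve_unit * root_cond)"
      using sk rho_bounds(3) by linarith
  qed simp
  then show LZ: "spectral_norm (L ** Z) \<le> 103 / 100" using P(4) by simp
  let ?V = "L ** Y ** matrix_inv T" and ?D = "L ** (Z ** T - Y) ** matrix_inv T"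
  let ?c = "chol_unit * root_cond\<^sup>2"
  have c0: "0 < ?c" "0 < gram_unit * root_cond\<^sup>2" using units root_cond_ge_1 by simp_all
  have "114 / 100 * (solve_unit * root_cond) * spectral_norm (L ** Z) \<le> 114 / 100 * ?c * (103 / 100)"
    using sk LZ units mult_right_mono[OF units(3), of "root_cond\<^sup>2"] root_cond_ge_1 by (intro mult_mono) auto
  then have D: "norm ?D \<le> 118 / 100 * ?c"
    using P(2) c0 by linarith
  have V: "norm (transpose ?V ** ?V - mat 1)
      \<le> 100 / 91 * (313 / 100 * (gram_unit * root_cond\<^sup>2) + 116 / 100 * ?c)"
    using order_trans[OF cholesky_quotient_orthogonality[OF inv \<tau>(1) \<tau>_le refl, of "L ** Y"]
        divide_right_mono[OF step(3)]] by (simp add: \<tau>(2))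
  have "(spectral_norm ?V + spectral_norm (L ** Z)) * norm ?D \<le> (1017 / 1000 + 103 / 100) * (118 / 100 * ?c)"
    using P(3) LZ D units by (intro mult_mono add_mono) auto
  then have "norm (transpose (L ** Z) ** (L ** Z) - mat 1)
      \<le> 100 / 91 * (313 / 100 * (gram_unit * root_cond\<^sup>2) + 116 / 100 * ?c)
        + (1017 / 1000 + 103 / 100) * (118 / 100 * ?c)"
    using gram_add_minus_identity_norm_le[of ?V ?D] V unfolding P(1)[symmetric] by linarith
  also have "\<dots> \<le> 8 * ((gram_unit + chol_unit) * root_cond\<^sup>2)"
    using c0 by (simp add: algebra_simps)
  finally show "norm (transpose Z ** B ** Z - mat 1) \<le> 8 * ((gram_unit + chol_unit) * root_cond\<^sup>2)"
    by (simp add: gram_eq)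
qed

text \<open>
  The bounds of one step are the premises of the next, along all four ways in which a run can end.
\<close>

lemma shifted_cholesky_qr3_bounds:
  fixes result :: "('m, 'n) factors option"
  assumes \<xi>: "0 < (spectral_norm X)\<^sup>2 * spectral_norm B"
    and \<sigma>: "\<And>w. 9216 * (2 * gram_unit + chol_unit) * rho\<^sup>2 * ((spectral_norm X)\<^sup>2 * spectral_norm B)
        * (norm w)\<^sup>2 \<le> (norm ((L ** X) *v w))\<^sup>2"
    and run: "shifted_cholesky_qr3_run u B X result"
  shows "\<exists>Q R. result = Some (Q, R) \<and> upper_triangular R
    \<and> norm (transpose Q ** B ** Q - mat 1) \<le> 8 * ((gram_unit + chol_unit) * root_cond\<^sup>2)
    \<and> norm (Q ** R - X) \<le> 16 * solve_unit * root_cond * spectral_norm X"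
proof -
  define \<xi> where "\<xi> = (spectral_norm X)\<^sup>2 * spectral_norm B"
  define s where "s = cholesky_shift u B X"
  have s: "s = 11 * (2 * gram_unit + chol_unit) * ((spectral_norm X)\<^sup>2 * spectral_norm B)"
    by (simp add: s_def cholesky_shift_def gram_unit_def chol_unit_def algebra_simps)
  have r36: "36 * rho\<^sup>2 * (norm w)\<^sup>2 \<le> (norm x)\<^sup>2" if "6 * rho * norm w \<le> norm x"
    for w :: "real^'n::{finite,linorder}" and x :: "real^'m"
    using power_mono[OF that, of 2] rho_pos by (simp add: power_mult_distrib)
  have sq: "(spectral_norm M)\<^sup>2 \<le> 106 / 100" if "spectral_norm M \<le> 1028 / 1000"
    for M :: "real^'n::{finite,linorder}^'m"
    using power_mono[OF that, of 2] by (simp add: power2_eq_square[of "_ / _"])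
  have first: "\<exists>Z T. q = Some (Z, T) \<and> upper_triangular T \<and> fl_solve u X T Z
      \<and> (spectral_norm T)\<^sup>2 \<le> 135 / 100 * \<xi> \<and> spectral_norm (L ** Z) \<le> 1022 / 1000
      \<and> (\<forall>v. 6 * rho * norm v \<le> norm ((L ** Z) *v v))"
    if "cholesky_qr_run u B s X q" for q
    using that
  proof cases
    case (success G T Z)
    then show ?thesis
      using first_step(2)[OF success(2) \<xi> \<sigma>, of T Z] fl_chol_factor(1)[OF success(3)]
      unfolding s \<xi>_def by simp
  next
    case (breakdown G)
    then show ?thesis using first_step(1)[OF breakdown(2) \<xi> \<sigma>] unfolding s by blast
  qed
  have next_step: "\<exists>Z T. q = Some (Z, T) \<and> upper_triangular T \<and> fl_solve u Y T Z
      \<and> (spectral_norm T)\<^sup>2 \<le> 113 / 100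
      \<and> (\<exists>G. fl_gram u B Y G \<and> fl_chol u (G + mat 0) (Some T))"
    if q: "cholesky_qr_run u B 0 Y q" and \<omega>: "spectral_norm (L ** Y) \<le> 1028 / 1000"
      and \<alpha>: "\<And>v. 6 * rho * norm v \<le> norm ((L ** Y) *v v)"
    for q and Y :: "real^'n::{finite,linorder}^'m"
  proof -
    have \<omega>2: "(spectral_norm (L ** Y))\<^sup>2 \<le> 106 / 100" by (rule sq) (use \<omega> in simp)
    have \<alpha>2: "36 * rho\<^sup>2 * (norm w)\<^sup>2 \<le> (norm ((L ** Y) *v w))\<^sup>2" for w
      by (rule r36[OF \<alpha>])
    show ?thesis
      using q
    proof cases
      case (success G T Z)
      then show ?thesis
        using unshifted_step(2)[OF success(2) \<omega>2 \<alpha>2 success(3)] fl_chol_factor(1)[OF success(3)]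
        by blast
    next
      case (breakdown G)
      then show ?thesis using unshifted_step(1)[OF breakdown(2) \<omega>2 \<alpha>2] by blast
    qed
  qed
  have rho6: "6 * rho \<le> 97 / 100"
  proof (rule power2_le_imp_le)
    show "(6 * rho)\<^sup>2 \<le> (97 / 100)\<^sup>2"
      using rho_bounds(1) by (simp add: power_mult_distrib power2_eq_square[of "97 / 100"])
  qed simp
  have second: "\<exists>Z T R'. q = Some (Z, R') \<and> upper_triangular R' \<and> fl_solve u Z1 T Z \<and> fl_mult u T T1 R'
      \<and> (spectral_norm T)\<^sup>2 \<le> 113 / 100 \<and> spectral_norm (L ** Z) \<le> 1028 / 1000
      \<and> (\<forall>v. 97 / 100 * norm v \<le> norm ((L ** Z) *v v))"
    if run: "reorthogonalize_run u B (Z1, T1) q" and T1: "upper_triangular T1"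
      and \<omega>: "spectral_norm (L ** Z1) \<le> 1022 / 1000"
      and \<alpha>: "\<And>v. 6 * rho * norm v \<le> norm ((L ** Z1) *v v)"
    for q and Z1 :: "real^'n::{finite,linorder}^'m" and T1
  proof -
    have "spectral_norm (L ** Z1) \<le> 1028 / 1000" using \<omega> by simp
    note step = next_step[OF _ this \<alpha>]
    have \<omega>2: "(spectral_norm (L ** Z1))\<^sup>2 \<le> 106 / 100" by (rule sq) (use \<omega> in simp)
    show ?thesis
      using run
    proof cases
      case (success Z T R')
      then obtain G where "upper_triangular T" "fl_solve u Z1 T Z" "(spectral_norm T)\<^sup>2 \<le> 113 / 100"
        and G: "fl_gram u B Z1 G" "fl_chol u (G + mat 0) (Some T)"
        using step by blast
      then show ?thesis
        using second_step[OF G(1) \<omega>2 r36[OF \<alpha>] G(2)] success fl_mult_upper_triangular[OF success(3)] T1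
        by blast
    next
      case breakdown
      then show ?thesis using step by blast
    qed
  qed
  have third: "\<exists>Z T R'. q = Some (Z, R') \<and> upper_triangular R' \<and> fl_solve u Z2 T Z \<and> fl_mult u T R2 R'
      \<and> (spectral_norm T)\<^sup>2 \<le> 113 / 100 \<and> spectral_norm (L ** Z) \<le> 103 / 100
      \<and> norm (transpose Z ** B ** Z - mat 1) \<le> 8 * ((gram_unit + chol_unit) * root_cond\<^sup>2)"
    if run: "reorthogonalize_run u B (Z2, R2) q" and R2: "upper_triangular R2"
      and \<omega>: "spectral_norm (L ** Z2) \<le> 1028 / 1000"
      and \<alpha>: "\<And>v. 97 / 100 * norm v \<le> norm ((L ** Z2) *v v)"
    for q and Z2 :: "real^'n::{finite,linorder}^'m" and R2
  proof -
    have "6 * rho * norm v \<le> norm ((L ** Z2) *v v)" for v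
      using \<alpha>[of v] rho6 by (meson mult_right_mono norm_ge_zero order_trans)
    note step = next_step[OF _ \<omega> this]
    have \<omega>2: "(spectral_norm (L ** Z2))\<^sup>2 \<le> 106 / 100" by (rule sq) (use \<omega> in simp)
    show ?thesis
      using run
    proof cases
      case (success Z T R')
      then obtain G where "upper_triangular T" "fl_solve u Z2 T Z" "(spectral_norm T)\<^sup>2 \<le> 113 / 100"
        and G: "fl_gram u B Z2 G" "fl_chol u (G + mat 0) (Some T)"
        using step by blast
      then show ?thesis
        using third_step[OF G(1) \<omega>2 \<alpha> G(2)] success fl_mult_upper_triangular[OF success(3)] R2
        by blast
    next
      case breakdown
      then show ?thesis using step by blast
    qed
  qed
  from run show ?thesis
  proof cases
    case (success QR1 QR2 QR3)
    obtain Z1 T1 where 1: "QR1 = (Z1, T1)" "upper_triangular T1" "fl_solve u X T1 Z1"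
      "(spectral_norm T1)\<^sup>2 \<le> 135 / 100 * \<xi>" "spectral_norm (L ** Z1) \<le> 1022 / 1000"
      "\<And>v. 6 * rho * norm v \<le> norm ((L ** Z1) *v v)"
      using first[where q = "Some QR1"] success(2) unfolding s_def option.inject by blast
    obtain Z2 T2 R2 where 2: "QR2 = (Z2, R2)" "upper_triangular R2" "fl_solve u Z1 T2 Z2"
      "fl_mult u T2 T1 R2" "(spectral_norm T2)\<^sup>2 \<le> 113 / 100" "spectral_norm (L ** Z2) \<le> 1028 / 1000"
      "\<And>v. 97 / 100 * norm v \<le> norm ((L ** Z2) *v v)"
      using second[OF _ 1(2,5,6), where q = "Some QR2"] success(3) unfolding 1(1) option.inject by blast
    obtain Z3 T3 R3 where 3: "QR3 = (Z3, R3)" "upper_triangular R3" "fl_solve u Z2 T3 Z3"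
      "fl_mult u T3 R2 R3" "(spectral_norm T3)\<^sup>2 \<le> 113 / 100" "spectral_norm (L ** Z3) \<le> 103 / 100"
      "norm (transpose Z3 ** B ** Z3 - mat 1) \<le> 8 * ((gram_unit + chol_unit) * root_cond\<^sup>2)"
      using third[OF _ 2(2,6,7), where q = "Some QR3"] success(4) unfolding 2(1) option.inject by blast
    define c where "c = 102 / 100 * solve_unit"
    have su: "0 < solve_unit" "solve_unit \<le> 1 / 80" using units units_small by linarith+
    have c: "0 \<le> c" "c \<le> 1 / 50" using su by (auto simp: c_def)
    have fm: "norm (P - S ** T) \<le> c * (spectral_norm S * spectral_norm T)" if "fl_mult u S T P"
      for S T P :: "real^'n::{finite,linorder}^'n::{finite,linorder}"
      using fl_mult_error[OF that u_pos unit_bounds(2)] by (simp add: c_def solve_unit_def)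
    have z: "spectral_norm Z \<le> inv_factor_norm * (103 / 100)" if "spectral_norm (L ** Z) \<le> 103 / 100"
      for Z :: "real^'n::{finite,linorder}^'m"
      using order_trans[OF spectral_norm_le_inv_factor_norm mult_left_mono[OF that factor_norm_nonneg(2)]] .
    have t: "spectral_norm T \<le> 107 / 100" if "(spectral_norm T)\<^sup>2 \<le> 113 / 100"
      for T :: "real^'n::{finite,linorder}^'n::{finite,linorder}"
      by (rule power2_le_imp_le) (use that in \<open>auto simp: power2_eq_square\<close>)
    have t1: "spectral_norm T1 \<le> 117 / 100 * (spectral_norm X * factor_norm)"
    proof (rule power2_le_imp_le)
      have "135 / 100 * \<xi> \<le> (117 / 100)\<^sup>2 * \<xi>"
        using \<xi> unfolding \<xi>_def by (intro mult_right_mono) (auto simp: power2_eq_square)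
      then show "(spectral_norm T1)\<^sup>2 \<le> (117 / 100 * (spectral_norm X * factor_norm))\<^sup>2"
        using 1(4) unfolding power_mult_distrib \<xi>_def factor_norm_def by simp
      show "0 \<le> 117 / 100 * (spectral_norm X * factor_norm)" using factor_norm_nonneg by simp
    qed
    have "norm (Z3 ** R3 - X) \<le> c * (inv_factor_norm * (103 / 100) * (117 / 100 * (spectral_norm X * factor_norm)))
        * (1 + 107 / 100 + (3 + c) * (107 / 100)\<^sup>2)"
    proof (rule three_step_backward_error)
      show "norm (Z1 ** T1 - X) \<le> c * (spectral_norm Z1 * spectral_norm T1)"
        "norm (Z2 ** T2 - Z1) \<le> c * (spectral_norm Z2 * spectral_norm T2)"
        "norm (Z3 ** T3 - Z2) \<le> c * (spectral_norm Z3 * spectral_norm T3)"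
        unfolding c_def by (intro solve_residual 1 2 3)+
      show "norm (R2 - T2 ** T1) \<le> c * (spectral_norm T2 * spectral_norm T1)"
        "norm (R3 - T3 ** R2) \<le> c * (spectral_norm T3 * spectral_norm R2)"
        by (intro fm 2 3)+
      show "spectral_norm Z1 \<le> inv_factor_norm * (103 / 100)" "spectral_norm Z2 \<le> inv_factor_norm * (103 / 100)"
        "spectral_norm Z3 \<le> inv_factor_norm * (103 / 100)"
        by (rule z, use 1(5) 2(6) 3(6) in linarith)+
    qed (intro t t1 2 3 c)+
    also have "\<dots> = 1229202 / 1000000 * (solve_unit * root_cond * spectral_norm X)
        * (1 + 107 / 100 + (3 + c) * (107 / 100)\<^sup>2)"
      by (simp add: c_def factor_norm_product[symmetric])
    also have "\<dots> \<le> 1229202 / 1000000 * (solve_unit * root_cond * spectral_norm X) * 10"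
    proof (rule mult_left_mono)
      show "1 + 107 / 100 + (3 + c) * (107 / 100)\<^sup>2 \<le> 10"
      proof -
        have "(3 + c) * (107 / 100)\<^sup>2 \<le> 4 * (107 / 100)\<^sup>2"
          using c by (intro mult_right_mono) auto
        also have "\<dots> \<le> 5" by (simp add: power2_eq_square)
        finally show ?thesis by linarith
      qed
      show "0 \<le> 1229202 / 1000000 * (solve_unit * root_cond * spectral_norm X)"
        using su root_cond_ge_1 by simp
    qed
    also have "\<dots> \<le> 16 * (solve_unit * root_cond * spectral_norm X)" using su root_cond_ge_1 by simp
    finally show ?thesis using 3 success(1) by (simp add: mult_ac)
  next
    case breakdown1
    then show ?thesis using first unfolding s_def by blast
  next
    case (breakdown2 QR1)
    obtain Z1 T1 where 1: "QR1 = (Z1, T1)" "upper_triangular T1"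
      "spectral_norm (L ** Z1) \<le> 1022 / 1000" "\<And>v. 6 * rho * norm v \<le> norm ((L ** Z1) *v v)"
      using first[where q = "Some QR1"] breakdown2(2) unfolding s_def option.inject by blast
    show ?thesis using second[OF _ 1(2-4), where q = None] breakdown2(3) unfolding 1(1) option.inject by blast
  next
    case (breakdown3 QR1 QR2)
    obtain Z1 T1 where 1: "QR1 = (Z1, T1)" "upper_triangular T1"
      "spectral_norm (L ** Z1) \<le> 1022 / 1000" "\<And>v. 6 * rho * norm v \<le> norm ((L ** Z1) *v v)"
      using first[where q = "Some QR1"] breakdown3(2) unfolding s_def option.inject by blast
    obtain Z2 R2 where 2: "QR2 = (Z2, R2)" "upper_triangular R2"
      "spectral_norm (L ** Z2) \<le> 1028 / 1000" "\<And>v. 97 / 100 * norm v \<le> norm ((L ** Z2) *v v)"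
      using second[OF _ 1(2-4), where q = "Some QR2"] breakdown3(3) unfolding 1(1) option.inject by blast
    show ?thesis using third[OF _ 2(2-4), where q = None] breakdown3(4) unfolding 2(1) option.inject by blast
  qed
qed

end

section \<open>Accuracy of shifted CholeskyQR3\<close>

lemma powr_three_halves: "1 \<le> x \<Longrightarrow> sqrt x \<le> x powr (3 / 2)" for x :: real
  using powr_mono[of "1 / 2" "3 / 2" x] powr_half_sqrt[of x] by simp

theorem theorem5p4:
  fixes B :: "real^'m^'m" and X :: "real^'n::{finite,linorder}^'m" and u :: real and m n :: nat
  assumes "m = CARD('m)" and "n = CARD('n)" and "n \<le> m"
    and "0 < u"
    and "pos_def B"
    and "u powr (-1/2)
           < spectral_norm X * sqrt (spectral_norm B) / sqrt (sigma_min (transpose X ** B ** X))"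
    and "spectral_norm X * sqrt (spectral_norm B) / sqrt (sigma_min (transpose X ** B ** X))
           \<le> inverse u / (96 * (2 * m * sqrt (m * n) + n * (n + 1)) * sqrt (cond2 B))"
    and "80 * cond2 B * (m * sqrt (m * n) * u + n * (n + 1) * u) \<le> 1"
  shows "\<forall>result. shifted_cholesky_qr3_run u B X result \<longrightarrow>
           (\<exists>Q R. result = Some (Q, R) \<and>
              upper_triangular R \<and>
              norm (transpose Q ** B ** Q - mat 1)
                \<le> 8 * (m * sqrt (m * n) * u + n * (n + 1) * u) * cond2 B \<and>
              norm (Q ** R - X) / spectral_norm X
                \<le> 16 * n\<^sup>2 * u * cond2 B powr (3/2))"
proof -
  obtain L :: "real^'m^'m" where L: "B = transpose L ** L" "invertible L"
    using pos_def_factor[OF assms(5)] .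
  interpret cholesky_qr_rounding u B L X
  proof
    show "80 * cond2 B * (real CARD('m) * sqrt (real CARD('m) * real CARD('n)) * u
        + real CARD('n) * (real CARD('n) + 1) * u) \<le> 1"
      using assms(8) unfolding assms(1,2) by (simp add: algebra_simps)
  qed (use assms L in simp_all)
  let ?\<xi> = "(spectral_norm X)\<^sup>2 * spectral_norm B" and ?\<sigma> = "sigma_min (transpose X ** B ** X)"
  let ?g = "2 * gram_unit + chol_unit"
  have units_eq: "gram_unit = real m * sqrt (real m * real n) * u" "chol_unit = real n * (real n + 1) * u"
    "solve_unit = (real n)\<^sup>2 * u"
    by (simp_all add: gram_unit_def chol_unit_def solve_unit_def assms(1,2))
  have "0 < u powr (-1/2)" using assms(4) by simp
  \<comment> \<open>Division by zero yields zero, so a positive ratio excludes a singular \<open>X\<^sup>T B X\<close>.\<close>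
  then have ratio: "0 < spectral_norm X * factor_norm / sqrt ?\<sigma>" 
    using order.strict_trans[OF _ assms(6)] by (simp only: factor_norm_def)
  have "0 \<le> ?\<sigma>" using sigma_min_bound by blast
  have \<sigma>: "0 < ?\<sigma>" and x: "0 < spectral_norm X" "0 < factor_norm"
    using ratio \<open>0 \<le> ?\<sigma>\<close> factor_norm_nonneg(1) spectral_norm_nonneg[of X]
    by (auto simp: zero_less_divide_iff zero_less_mult_iff order.order_iff_strict)
  have \<xi>: "0 < ?\<xi>" using x by (simp add: factor_norm_def)
  have g: "0 < ?g" using units by linarith
  have "spectral_norm X * factor_norm / sqrt ?\<sigma> \<le> inverse u / (96 * (?g / u) * root_cond)"
    using assms(4,7) by (simp add: units_eq factor_norm_def root_cond_def add_divide_distrib algebra_simps)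
  also have "\<dots> = 1 / (96 * ?g * root_cond)" using assms(4) by (simp add: field_simps)
  finally have "spectral_norm X * factor_norm \<le> 1 / (96 * ?g * root_cond) * sqrt ?\<sigma>"
    using \<sigma> by (simp only: pos_divide_le_eq real_sqrt_gt_zero)
  moreover have "0 < 96 * ?g * root_cond" using g root_cond_ge_1 by simp
  moreover have "d * y \<le> z" if "y \<le> 1 / d * z" "0 < d" for d y z :: real
    using that by (simp add: field_simps)
  ultimately have "96 * ?g * root_cond * (spectral_norm X * factor_norm) \<le> sqrt ?\<sigma>" by blast
  then have "(96 * ?g * root_cond * (spectral_norm X * factor_norm))\<^sup>2 \<le> (sqrt ?\<sigma>)\<^sup>2"
    using g root_cond_ge_1 x by (intro power_mono) auto
  moreover have "(96 * ?g * root_cond * (spectral_norm X * factor_norm))\<^sup>2 = 9216 * ?g * rho\<^sup>2 * ?\<xi>"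
  proof -
    have "(96 * g * k * (y * l))\<^sup>2 = 9216 * g * (g * k\<^sup>2) * (y\<^sup>2 * l\<^sup>2)" for g k y l :: real
      by (simp add: power2_eq_square)
    moreover have "factor_norm\<^sup>2 = spectral_norm B" by (simp add: factor_norm_def)
    ultimately show ?thesis unfolding rho_power2 by (simp only:)
  qed
  ultimately have key: "9216 * ?g * rho\<^sup>2 * ?\<xi> \<le> ?\<sigma>" using \<sigma> by simp
  have \<sigma>_le: "9216 * ?g * rho\<^sup>2 * ?\<xi> * (norm w)\<^sup>2 \<le> (norm ((L ** X) *v w))\<^sup>2" for w
    using order_trans[OF mult_right_mono[OF key zero_le_power2] sigma_min_gram_le[of "L ** X" w, folded gram_eq]] .
  have backward: "norm M / spectral_norm X \<le> 16 * n\<^sup>2 * u * cond2 B powr (3/2)"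
    if "norm M \<le> 16 * solve_unit * root_cond * spectral_norm X" for M :: "real^'n::{finite,linorder}^'m"
  proof -
    have "1 \<le> cond2 B" using root_cond_ge_1 by (simp add: root_cond_def)
    then have "root_cond \<le> cond2 B powr (3/2)" unfolding root_cond_def by (rule powr_three_halves)
    then have "16 * solve_unit * root_cond \<le> 16 * solve_unit * cond2 B powr (3/2)"
      using units by (intro mult_left_mono) auto
    moreover have "norm M / spectral_norm X \<le> 16 * solve_unit * root_cond"
      using that x(1) by (simp add: pos_divide_le_eq)
    ultimately show ?thesis by (simp add: units_eq)
  qed
  show ?thesis
  proof (intro allI impI)
    fix result assume "shifted_cholesky_qr3_run u B X result"
    from shifted_cholesky_qr3_bounds[OF \<xi> \<sigma>_le this] obtain Q R
      where QR: "result = Some (Q, R)" "upper_triangular R"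
        "norm (transpose Q ** B ** Q - mat 1) \<le> 8 * ((gram_unit + chol_unit) * root_cond\<^sup>2)"
        "norm (Q ** R - X) \<le> 16 * solve_unit * root_cond * spectral_norm X" by blast
    have "norm (transpose Q ** B ** Q - mat 1)
        \<le> 8 * (m * sqrt (m * n) * u + n * (n + 1) * u) * cond2 B"
      using QR(3) by (simp add: root_cond_power2 units_eq algebra_simps)
    then show "\<exists>Q R. result = Some (Q, R) \<and>
              upper_triangular R \<and>
              norm (transpose Q ** B ** Q - mat 1)
                \<le> 8 * (m * sqrt (m * n) * u + n * (n + 1) * u) * cond2 B \<and>
              norm (Q ** R - X) / spectral_norm X
                \<le> 16 * n\<^sup>2 * u * cond2 B powr (3/2)"
      using QR(1,2) backward[OF QR(4)] by (intro exI[of _ Q] exI[of _ R] conjI)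
  qed
qed

end
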